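(* There exist absolute constants $C, c > 0$ such that the following holds. Let $n \ge 2$ and let $D$ be a fixed $n \times n$ real matrix. Assume that $$\|D\| \le K, \qquad \inf_{V \in O(n)} \|D - V\| \ge \delta$$ for some $K \ge 1$ and $\delta \in (0,1)$. Let $U$ be a random matrix uniformly distributed in the orthogonal group $O(n)$. Then $$\mathbb{P}\{ s_{\min}(D+U) \le t \} \le t^{c}\, (Kn/\delta)^{C} \quad \text{for all } t > 0.$$
   Context: $\|\cdot\|$ denotes the operator norm of a matrix and $s_{\min}(A)$ the smallest singular value of a square matrix $A$. "Uniformly distributed" means distributed according to the normalized Haar measure. The constants $C,c$ do not depend on $n, D, K, \delta, t$. *)

theory Defs
  imports "HOL-Probability.Probability" "Jordan_Normal_Form.Char_Poly"
begin

(* Matrices are those of Jordan_Normal_Form, so that the dimension n is an ordinary variable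
   and can be quantified inside the scope of the absolute constants. *)

definition l2_norm_vec :: "real Matrix.vec \<Rightarrow> real" where
  "l2_norm_vec x = sqrt (scalar_prod x x)"

definition op_norm :: "real Matrix.mat \<Rightarrow> real" where
  "op_norm A = (SUP x\<in>{x \<in> carrier_vec (dim_col A). l2_norm_vec x \<le> 1}. l2_norm_vec (A *\<^sub>v x))"

definition singular_values :: "real Matrix.mat \<Rightarrow> real set" where
  "singular_values A = {sqrt l | l. eigenvalue (transpose_mat A * A) l}"

(* singular_values A is finite and, for square A of positive size, nonempty. *)
definition s_min :: "real Matrix.mat \<Rightarrow> real" where
  "s_min A = Min (singular_values A)"

(* Not the library's orthogonal_mat, which only requires the columns to be
   pairwise orthogonal and nonzero. *)
definition orthogonal_group :: "nat \<Rightarrow> real Matrix.mat set" where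
  "orthogonal_group n = {V \<in> carrier_mat n n. transpose_mat V * V = 1\<^sub>m n}"

(* The Borel sigma-algebra of O(n) for the topology inherited from the n^2-dimensional
   Euclidean space of matrices, obtained by pulling back the product Borel sigma-algebra
   along the matrix entries; the measure carried by vimage_algebra itself is irrelevant. *)
definition borel_orthogonal :: "nat \<Rightarrow> real Matrix.mat measure" where
  "borel_orthogonal n =
     vimage_algebra (orthogonal_group n)
       (\<lambda>V. \<lambda>ij\<in>{..<n} \<times> {..<n}. V $$ ij)
       (PiM ({..<n} \<times> {..<n}) (\<lambda>_. borel))"

(* Normalized Haar measure on O(n): the left-invariant Borel probability measure. *)
definition normalized_haar :: "nat \<Rightarrow> real Matrix.mat measure \<Rightarrow> bool" where
  "normalized_haar n \<mu> \<longleftrightarrow>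
     prob_space \<mu> \<and> sets \<mu> = sets (borel_orthogonal n) \<and>
     (\<forall>V\<in>orthogonal_group n. distr \<mu> \<mu> (\<lambda>U. V * U) = \<mu>)"

end

theory Submission
  imports Defs "Jordan_Normal_Form.Spectral_Radius"
begin

text \<open>
  By the singular value decomposition and the two-sided invariance of \<open>\<mu>\<close> one may take
  \<open>D = diag(d)\<close>.  If all \<open>d i\<close> are within \<open>\<delta>/2\<close> of each other, they lie on the same side
  of \<open>1\<close>, and \<open>D + U\<close> is deterministically well invertible.  Otherwise some \<open>d p\<close>, \<open>d q\<close>
  differ, and one argues as in the fractional moment method: it suffices to bound each quotient
  \<open>N / det (D + U)\<close> where \<open>N\<close> arises from \<open>det (D + U)\<close> by replacing its row \<open>k\<close> by the row
  \<open>j\<close> of \<open>U\<close> (Cramer's rule).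

  If one rotates two rows or two columns of \<open>U\<close> by an angle, \<open>det (D + U)\<close> becomes an affine
  function of the sine and cosine of the angle, so it is rarely much smaller than its maximum
  over the angle.  Averaging over finitely many rational rotations turns this into a bound for the
  probability that \<open>det (D + U)\<close> is much smaller than \<open>det (D' + U)\<close>, where \<open>D'\<close> arises from
  \<open>D\<close> by a bounded number of quarter and half turns in coordinate planes.  A combination of these
  determinants bounds \<open>N\<close>, because \<open>d p\<close> and \<open>d q\<close> differ.
\<close>

subsection \<open>Determinants as functions of the rows\<close>

text \<open>No lower bound for \<open>det (D + U)\<close> alone can be the starting point: for D = 1
  it vanishes for every U of determinant -1. Hence only determinants at the same U are compared, and
  the distance of D from O(n) enters either through the side of 1 on which the singular values lie
  or through division by a gap between two of them. The row inserted in Cramer's rule comes from U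
  because U x is a unit vector whenever x is, so some row of U has a product with x of size at least
  1/n. Seven turns always suffice, whatever n is. For a free parameter N, each turn costs a factor
  200 N^2 and fails with probability at most 2/N. Since only polynomially many matrices D' arise, a
  union bound over them is affordable. The total loss is of order (N^2)^7 = N^14, which is where the
  exponent 1/14 comes from. Dividing by \<open>det (D + U)\<close> requires it to be nonzero. This
  is arranged, up to an arbitrarily small probability, by adding a small multiple of the identity to
  D.\<close>

definition rdet :: "nat \<Rightarrow> (nat \<Rightarrow> nat \<Rightarrow> real) \<Rightarrow> real" where
  "rdet n r = Determinant.det (Matrix.mat n n (\<lambda>(i,j). r i j))"

lemma rdet_cong: "(\<And>i j. i < n \<Longrightarrow> j < n \<Longrightarrow> r i j = r' i j) \<Longrightarrow> rdet n r = rdet n r'"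
  unfolding rdet_def by (intro arg_cong[of _ _ Determinant.det] eq_matI) auto

lemma rdet_transpose: "rdet n (\<lambda>i j. r j i) = rdet n r"
proof -
  have "Matrix.mat n n (\<lambda>(i,j). r j i) = transpose_mat (Matrix.mat n n (\<lambda>(i,j). r i j))"
    by (intro eq_matI) auto
  then show ?thesis
    unfolding rdet_def by (simp add: det_transpose[of _ n])
qed

text \<open>Cofactors along row \<open>k\<close> do not involve row \<open>k\<close>, so those of
  the original matrix serve for every replacement \<open>v\<close>.\<close>

lemma rdet_row_cofactor:
  assumes "k < n"
  shows "rdet n (r(k := v)) = (\<Sum>j<n. v j * cofactor (Matrix.mat n n (\<lambda>(i,j). r i j)) k j)"
proof -
  let ?A = "Matrix.mat n n (\<lambda>(i,j). r i j)"
  let ?M = "Matrix.mat n n (\<lambda>(i,j). (r(k := v)) i j)"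
  have "mat_delete ?M k j = mat_delete ?A k j" if "j < n" for j
    using that assms unfolding mat_delete_def by (intro eq_matI) (auto simp: fun_upd_def)
  then have cof: "cofactor ?M k j = cofactor ?A k j" if "j < n" for j
    using that by (simp add: cofactor_def)
  have "rdet n (r(k := v)) = (\<Sum>j<n. ?M $$ (k,j) * cofactor ?M k j)"
    unfolding rdet_def by (rule laplace_expansion_row) (use assms in auto)
  also have "\<dots> = (\<Sum>j<n. v j * cofactor ?A k j)"
    by (intro sum.cong refl) (use assms cof in \<open>simp del: fun_upd_apply, simp\<close>)
  finally show ?thesis .
qed

lemma rdet_row_expansion:
  assumes "k < n"
  obtains C where "\<And>v. rdet n (r(k := v)) = (\<Sum>j<n. v j * C j)"
  using rdet_row_cofactor[OF assms] by blast

lemma rdet_row_linear: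
  assumes "k < n"
  shows "rdet n (r(k := \<lambda>j. a * v j + b * w j)) = a * rdet n (r(k := v)) + b * rdet n (r(k := w))"
proof -
  obtain C where "\<And>v. rdet n (r(k := v)) = (\<Sum>j<n. v j * C j)"
    using rdet_row_expansion[OF assms, of r] by blast
  then show ?thesis
    by (simp add: sum_distrib_left algebra_simps sum.distrib)
qed

lemma rdet_eq_rows:
  assumes "p \<noteq> q" "p < n" "q < n" "r p = r q"
  shows "rdet n r = 0"
  unfolding rdet_def
  by (rule det_identical_rows[of _ n p q]) (use assms in \<open>auto simp: Matrix.row_def\<close>)

text \<open>Turns the determinant into an alternating bilinear form in two chosen rows. The
  expansions that produce and bound the numerators take place in this form.\<close>

definition rdet2 :: "nat \<Rightarrow> (nat \<Rightarrow> nat \<Rightarrow> real) \<Rightarrow> nat \<Rightarrow> nat \<Rightarrow> (nat \<Rightarrow> real) \<Rightarrow> (nat \<Rightarrow> real) \<Rightarrow> real"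
  where "rdet2 n r p q v w = rdet n (r(p := v, q := w))"

lemma rdet_eq_rdet2: "rdet n r = rdet2 n r p q (r p) (r q)"
  by (simp add: rdet2_def)

lemma rdet2_linear_right:
  assumes "q < n"
  shows "rdet2 n r p q v (\<lambda>j. a * w j + b * w' j) = a * rdet2 n r p q v w + b * rdet2 n r p q v w'"
  unfolding rdet2_def by (rule rdet_row_linear[OF assms])

lemma rdet2_linear_left:
  assumes "p < n" "p \<noteq> q"
  shows "rdet2 n r p q (\<lambda>j. a * v j + b * v' j) w = a * rdet2 n r p q v w + b * rdet2 n r p q v' w"
  unfolding rdet2_def fun_upd_twist[OF assms(2)] by (rule rdet_row_linear[OF assms(1)])

lemma rdet2_add_right:
  assumes "q < n"
  shows "rdet2 n r p q v (\<lambda>j. w j + w' j) = rdet2 n r p q v w + rdet2 n r p q v w'"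
  using rdet2_linear_right[OF assms, of r p v 1 w 1 w'] by simp

lemma rdet2_add_left:
  assumes "p < n" "p \<noteq> q"
  shows "rdet2 n r p q (\<lambda>j. v j + v' j) w = rdet2 n r p q v w + rdet2 n r p q v' w"
  using rdet2_linear_left[OF assms, of r 1 v 1 v' w] by simp

lemma rdet2_scale_right:
  assumes "q < n"
  shows "rdet2 n r p q v (\<lambda>j. a * w j) = a * rdet2 n r p q v w"
  using rdet2_linear_right[OF assms, of r p v a w 0 w] by simp

lemma rdet2_scale_left:
  assumes "p < n" "p \<noteq> q"
  shows "rdet2 n r p q (\<lambda>j. a * v j) w = a * rdet2 n r p q v w"
  using rdet2_linear_left[OF assms, of r a v 0 v w] by simp

lemma rdet2_same:
  assumes "p < n" "q < n" "p \<noteq> q"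
  shows "rdet2 n r p q v v = 0"
  unfolding rdet2_def by (rule rdet_eq_rows[of p q]) (use assms in auto)

lemma rdet2_swap:
  assumes "p < n" "q < n" "p \<noteq> q"
  shows "rdet2 n r p q v w = - rdet2 n r p q w v"
proof -
  have "0 = rdet2 n r p q (\<lambda>j. v j + w j) (\<lambda>j. v j + w j)"
    using rdet2_same[OF assms] by simp
  also have "\<dots> = rdet2 n r p q v w + rdet2 n r p q w v"
    using assms by (simp add: rdet2_add_left rdet2_add_right rdet2_same)
  finally show ?thesis by simp
qed

text \<open>Cramer's rule in a division-free form: if \<open>A\<close> has the rows \<open>r\<close>, then
  \<open>v adj(A) A x = det(A) (v x)\<close>.\<close>

lemma rdet_cramer:
  "(\<Sum>j<n. v j * x j) * rdet n r = (\<Sum>k<n. (\<Sum>j<n. r k j * x j) * rdet n (r(k := v)))"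
proof -
  let ?A = "Matrix.mat n n (\<lambda>(i,j). r i j)"
  have A: "?A \<in> carrier_mat n n" by simp
  note cof = rdet_row_cofactor[of _ n r v]
  have adj: "(\<Sum>k<n. cofactor ?A k j * r k i) = (if i = j then rdet n r else 0)"
    if ij: "i < n" "j < n" for i j
  proof -
    have "(adj_mat ?A * ?A) $$ (j,i) = (rdet n r \<cdot>\<^sub>m 1\<^sub>m n) $$ (j,i)"
      using adj_mat(3)[OF A] by (simp add: rdet_def)
    moreover have "(adj_mat ?A * ?A) $$ (j,i) = (\<Sum>k<n. cofactor ?A k j * r k i)"
      using ij adj_mat(1)[OF A]
      by (auto simp: scalar_prod_def adj_mat_def atLeast0LessThan intro!: sum.cong)
    ultimately show ?thesis using ij by auto
  qed
  have "(\<Sum>k<n. (\<Sum>j<n. r k j * x j) * rdet n (r(k := v)))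
      = (\<Sum>k<n. \<Sum>i<n. \<Sum>j<n. x i * v j * (cofactor ?A k j * r k i))"
    by (simp add: cof sum_product algebra_simps cong: sum.cong_simp)
  also have "\<dots> = (\<Sum>i<n. \<Sum>k<n. \<Sum>j<n. x i * v j * (cofactor ?A k j * r k i))"
    by (rule sum.swap)
  also have "\<dots> = (\<Sum>i<n. \<Sum>j<n. \<Sum>k<n. x i * v j * (cofactor ?A k j * r k i))"
    by (intro sum.cong refl sum.swap)
  also have "\<dots> = (\<Sum>i<n. \<Sum>j<n. x i * v j * (if i = j then rdet n r else 0))"
    by (intro sum.cong refl, subst sum_distrib_left[symmetric]) (simp add: adj)
  also have "\<dots> = (\<Sum>i<n. x i * v i * rdet n r)"
    by (intro sum.cong refl) (simp add: if_distrib cong: if_cong)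
  finally show ?thesis
    by (simp add: sum_distrib_right sum_distrib_left mult_ac)
qed

text \<open>The three-term Pluecker relation, obtained from \<open>rdet_cramer\<close> for the
  matrix with \<open>u\<close>, \<open>u'\<close> in rows \<open>p\<close>, \<open>q\<close>. The
  vector x of that rule is the cofactor vector \<open>C\<close> representing the linear form that
  sends w to \<open>rdet2 n r p q w v'\<close>. This form kills every row other than
  \<open>p\<close> and \<open>q\<close>, so two terms survive.\<close>

lemma rdet2_plucker:
  assumes "p < n" "q < n" "p \<noteq> q"
  shows "rdet2 n r p q u u' * rdet2 n r p q v v'
    = rdet2 n r p q v u * rdet2 n r p q v' u' - rdet2 n r p q v u' * rdet2 n r p q v' u"
proof -
  let ?r = "r(p := u, q := u')"
  obtain C where C: "\<And>w. rdet n ((r(q := v'))(p := w)) = (\<Sum>j<n. w j * C j)"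
    using rdet_row_expansion[OF assms(1)] by blast
  then have C2: "(\<Sum>j<n. w j * C j) = rdet2 n r p q w v'" for w
    unfolding rdet2_def using assms fun_upd_twist[of p q] by metis
  have z: "rdet2 n r p q (r k) v' = 0 \<or> k = p \<or> k = q" if "k < n" for k
  proof -
    have "rdet2 n r p q (r k) v' = 0" if "k \<noteq> p" "k \<noteq> q"
      unfolding rdet2_def by (rule rdet_eq_rows[of p k]) (use that \<open>k < n\<close> assms in auto)
    then show ?thesis by blast
  qed
  have "rdet2 n r p q v v' * rdet n ?r
      = (\<Sum>k<n. rdet2 n r p q (?r k) v' * rdet n (?r(k := v)))"
    using rdet_cramer[of v C n ?r] unfolding C2 .
  also have "\<dots> = (\<Sum>k\<in>{p,q}. rdet2 n r p q (?r k) v' * rdet n (?r(k := v)))"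
    using assms z by (intro sum.mono_neutral_right) auto
  also have "\<dots> = rdet2 n r p q u v' * rdet2 n r p q v u' + rdet2 n r p q u' v' * rdet2 n r p q u v"
    using assms by (simp add: rdet2_def fun_upd_twist)
  finally show ?thesis
    using rdet2_swap[OF assms, of r u v'] rdet2_swap[OF assms, of r u' v'] rdet2_swap[OF assms, of r u v]
    by (simp add: rdet2_def algebra_simps)
qed

subsection \<open>Rotations of rows and columns\<close>

text \<open>A plane rotation when \<open>a\<close>, \<open>b\<close> are the cosine and sine of an
  angle. The sign sits in the coefficient \<open>(- b)\<close> so that both new rows have the shape
  \<open>a * v + b * w\<close> of the linearity lemmas.\<close>

definition rotate_rows :: "nat \<Rightarrow> nat \<Rightarrow> real \<Rightarrow> real \<Rightarrow> (nat \<Rightarrow> nat \<Rightarrow> real) \<Rightarrow> nat \<Rightarrow> nat \<Rightarrow> real" where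
  "rotate_rows p q a b X = X(p := \<lambda>j. a * X p j + b * X q j, q := \<lambda>j. a * X q j + (- b) * X p j)"

definition rotate_cols :: "nat \<Rightarrow> nat \<Rightarrow> real \<Rightarrow> real \<Rightarrow> (nat \<Rightarrow> nat \<Rightarrow> real) \<Rightarrow> nat \<Rightarrow> nat \<Rightarrow> real" where
  "rotate_cols p q a b X = (\<lambda>i j. rotate_rows p q a b (\<lambda>k l. X l k) j i)"

definition sum_det :: "nat \<Rightarrow> (nat \<Rightarrow> nat \<Rightarrow> real) \<Rightarrow> (nat \<Rightarrow> nat \<Rightarrow> real) \<Rightarrow> real" where
  "sum_det n X u = rdet n (\<lambda>i j. X i j + u i j)"

definition diag_fun :: "(nat \<Rightarrow> real) \<Rightarrow> nat \<Rightarrow> nat \<Rightarrow> real" where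
  "diag_fun x = (\<lambda>i j. if i = j then x i else 0)"

definition unit_fun :: "nat \<Rightarrow> nat \<Rightarrow> real" where
  "unit_fun a = (\<lambda>j. if j = a then 1 else 0)"

lemma rotate_rows_add: "rotate_rows p q a b (\<lambda>i j. X i j + Y i j) = (\<lambda>i j. rotate_rows p q a b X i j + rotate_rows p q a b Y i j)"
  by (auto simp: rotate_rows_def fun_eq_iff algebra_simps)

text \<open>The coefficients multiply like the complex numbers a + ib and c + id; in particular
  rotations in one plane commute.\<close>

lemma rotate_rows_rotate_rows:
  assumes "p \<noteq> q"
  shows "rotate_rows p q a b (rotate_rows p q c d X) = rotate_rows p q (a * c - b * d) (a * d + b * c) X"
  using assms by (auto simp: rotate_rows_def fun_eq_iff algebra_simps)

lemma rotate_rows_id: "rotate_rows p q 1 0 X = X"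
  by (auto simp: rotate_rows_def fun_eq_iff)

lemma rdet_rotate_rows:
  assumes "p < n" "q < n" "p \<noteq> q" "a\<^sup>2 + b\<^sup>2 = 1"
  shows "rdet n (rotate_rows p q a b X) = rdet n X"
proof -
  have "rdet n (rotate_rows p q a b X)
      = rdet2 n X p q (\<lambda>j. a * X p j + b * X q j) (\<lambda>j. a * X q j + (- b) * X p j)"
    by (simp add: rdet2_def rotate_rows_def)
  also have "\<dots> = a\<^sup>2 * rdet2 n X p q (X p) (X q) - b\<^sup>2 * rdet2 n X p q (X q) (X p)"
    using assms unfolding rdet2_linear_right[OF assms(2)] rdet2_linear_left[OF assms(1,3)]
    by (simp add: rdet2_same power2_eq_square algebra_simps)
  also have "\<dots> = (a\<^sup>2 + b\<^sup>2) * rdet n X"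
    using rdet2_swap[OF assms(1-3), of X "X q" "X p"]
    by (simp add: rdet_eq_rdet2[of n X p q] algebra_simps)
  finally show ?thesis using assms by simp
qed

text \<open>Transfers a rotation of the random matrix to the fixed one: the rotation is pulled out
  of the whole sum and leaves its inverse on \<open>X\<close>.\<close>

lemma sum_det_rotate_rows_rotate:
  assumes "p < n" "q < n" "p \<noteq> q" "a\<^sup>2 + b\<^sup>2 = 1"
  shows "sum_det n X (rotate_rows p q a b u) = sum_det n (rotate_rows p q a (- b) X) u"
proof -
  have "rotate_rows p q a b (rotate_rows p q a (- b) X) = X"
    using assms rotate_rows_id by (simp add: rotate_rows_rotate_rows power2_eq_square)
  then have "sum_det n X (rotate_rows p q a b u)
      = rdet n (rotate_rows p q a b (\<lambda>i j. rotate_rows p q a (- b) X i j + u i j))"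
    unfolding rotate_rows_add sum_det_def by simp
  then show ?thesis
    using rdet_rotate_rows[OF assms] by (simp add: sum_det_def)
qed

text \<open>Terms quadratic in \<open>a\<close>, \<open>b\<close> arise only when both rows come
  from \<open>X\<close>, and there the rotation multiplies the two-row determinant by a^2 + b^2 = 1.
  The coefficients depend on \<open>X\<close> and \<open>u\<close> but not on the angle.\<close>

lemma sum_det_rotate_rows_affine:
  assumes "p < n" "q < n" "p \<noteq> q"
  obtains \<alpha> \<beta> \<gamma> where
    "\<And>a b. a\<^sup>2 + b\<^sup>2 = 1 \<Longrightarrow> sum_det n (rotate_rows p q a b X) u = \<alpha> + \<beta> * a + \<gamma> * b"
proof
  let ?R = "rdet2 n (\<lambda>i j. X i j + u i j) p q"
  fix a b :: real assume ab: "a\<^sup>2 + b\<^sup>2 = 1"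
  have "sum_det n (rotate_rows p q a b X) u
      = ?R (\<lambda>j. (a * X p j + b * X q j) + u p j) (\<lambda>j. (a * X q j + (- b) * X p j) + u q j)"
    unfolding sum_det_def rdet2_def by (rule rdet_cong) (auto simp: rotate_rows_def)
  also have "\<dots> = (a\<^sup>2 + b\<^sup>2) * ?R (X p) (X q) + ?R (u p) (u q)
      + (?R (X p) (u q) + ?R (u p) (X q)) * a + (?R (X q) (u q) - ?R (u p) (X p)) * b"
    unfolding rdet2_add_right[OF assms(2)] rdet2_add_left[OF assms(1,3)]
      rdet2_scale_right[OF assms(2)] rdet2_scale_left[OF assms(1,3)]
    using assms rdet2_swap[OF assms, of "\<lambda>i j. X i j + u i j" "X q" "X p"]
    by (simp add: rdet2_same power2_eq_square algebra_simps)
  finally show "sum_det n (rotate_rows p q a b X) u = (?R (X p) (X q) + ?R (u p) (u q))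
      + (?R (X p) (u q) + ?R (u p) (X q)) * a + (?R (X q) (u q) - ?R (u p) (X p)) * b"
    using ab by simp
qed

section \<open>Turns acting on diagonal matrices, and the matrices reachable by them\<close>

lemma rotate_rows_neg_diag_fun:
  "p \<noteq> q \<Longrightarrow> rotate_rows p q (- 1) 0 (diag_fun x) = diag_fun (x(p := - x p, q := - x q))"
  by (auto simp: rotate_rows_def diag_fun_def fun_eq_iff)

lemma rotate_cols_rotate_rows_swap_diag_fun:
  "p \<noteq> q \<Longrightarrow> rotate_cols p q 0 1 (rotate_rows p q 0 1 (diag_fun x)) = diag_fun (x(p := x q, q := x p))"
  by (auto simp: rotate_rows_def rotate_cols_def diag_fun_def fun_eq_iff)

text \<open>Just enough turns for the algebra below: a half turn flips the signs of two diagonal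
  entries, a row and a column quarter turn together swap them, and a row quarter turn alone moves
  them off the diagonal.\<close>

definition moves :: "nat \<Rightarrow> ((nat \<Rightarrow> nat \<Rightarrow> real) \<Rightarrow> nat \<Rightarrow> nat \<Rightarrow> real) set" where
  "moves n = (\<lambda>(p,q). rotate_rows p q 0 1) ` {(p,q) \<in> {..<n} \<times> {..<n}. p \<noteq> q}
     \<union> (\<lambda>(p,q). rotate_rows p q (- 1) 0) ` {(p,q) \<in> {..<n} \<times> {..<n}. p \<noteq> q}
     \<union> (\<lambda>(p,q). rotate_cols p q 0 1) ` {(p,q) \<in> {..<n} \<times> {..<n}. p \<noteq> q}"

primrec reachable :: "nat \<Rightarrow> nat \<Rightarrow> (nat \<Rightarrow> nat \<Rightarrow> real) \<Rightarrow> (nat \<Rightarrow> nat \<Rightarrow> real) set" where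
  "reachable n 0 X = {X}"
| "reachable n (Suc m) X = reachable n m X \<union> (\<lambda>(F,Y). F Y) ` (moves n \<times> reachable n m X)"

lemma moves_intros:
  assumes "p < n" "q < n" "p \<noteq> q"
  shows "rotate_rows p q 0 1 \<in> moves n" "rotate_rows p q (- 1) 0 \<in> moves n" "rotate_cols p q 0 1 \<in> moves n"
  using assms unfolding moves_def by (auto intro!: image_eqI[where x = "(p,q)"])

lemma reachable_step: "Y \<in> reachable n m X \<Longrightarrow> F \<in> moves n \<Longrightarrow> F Y \<in> reachable n (Suc m) X"
  by (auto intro!: image_eqI[where x = "(F,Y)"])

lemma reachable_mono: "m \<le> m' \<Longrightarrow> Y \<in> reachable n m X \<Longrightarrow> Y \<in> reachable n m' X"
  by (induction m' rule: dec_induct) auto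

lemma reachable_self: "X \<in> reachable n m X"
  using reachable_mono[of 0 m X n X] by simp

lemma reachable_trans:
  assumes "Z \<in> reachable n k Y" "Y \<in> reachable n m X"
  shows "Z \<in> reachable n (m + k) X"
  using assms
proof (induction k arbitrary: Z)
  case 0
  then show ?case by simp
next
  case (Suc k)
  then consider "Z \<in> reachable n k Y" | F W where "F \<in> moves n" "W \<in> reachable n k Y" "Z = F W"
    by auto
  then show ?case
  proof cases
    case 1
    then show ?thesis using Suc by simp
  next
    case 2
    then show ?thesis using Suc.IH[of W] Suc.prems reachable_step[of W n "m + k" X F] by simp
  qed
qed

lemma reachable_neg:
  assumes "p < n" "q < n" "p \<noteq> q"
  shows "diag_fun (x(p := - x p, q := - x q)) \<in> reachable n 1 (diag_fun x)"
  using reachable_step[OF reachable_self[of "diag_fun x" n 0], OF moves_intros(2)[OF assms]] assms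
  by (simp add: rotate_rows_neg_diag_fun)

lemma reachable_swap:
  assumes "p < n" "q < n" "p \<noteq> q"
  shows "diag_fun (x(p := x q, q := x p)) \<in> reachable n 2 (diag_fun x)"
  using reachable_step[OF reachable_step[OF reachable_self[of "diag_fun x" n 0], OF moves_intros(1)[OF assms]]
      moves_intros(3)[OF assms]] assms
  unfolding rotate_cols_rotate_rows_swap_diag_fun[OF assms(3)] by (simp add: numeral_2_eq_2)

lemma reachable_quarter:
  assumes "p < n" "q < n" "p \<noteq> q"
  shows "rotate_rows p q 0 1 X \<in> reachable n 1 X"
  using reachable_step[OF reachable_self[of X n 0], OF moves_intros(1)[OF assms]] by simp

text \<open>Each step stays or applies one of at most 3 n^2 moves. A bound polynomial in n for fixed
  \<open>m\<close> is what the union bound over all targets can afford.\<close>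

lemma finite_card_reachable:
  "finite (reachable n m X) \<and> card (reachable n m X) \<le> (1 + 3 * n\<^sup>2) ^ m"
proof (induction m)
  case 0
  then show ?case by simp
next
  case (Suc m)
  define P where "P = {(p,q) \<in> {..<n} \<times> {..<n}. p \<noteq> q}"
  have P: "finite P" "card P \<le> n\<^sup>2"
  proof -
    have "P \<subseteq> {..<n} \<times> {..<n}" by (auto simp: P_def)
    then show "finite P" "card P \<le> n\<^sup>2"
      using card_mono[of "{..<n} \<times> {..<n}" P] finite_subset
      by (auto simp: power2_eq_square)
  qed
  have fin: "finite (moves n)"
    unfolding moves_def P_def[symmetric] using P by auto
  have "card (moves n) \<le> card P + card P + card P"
    unfolding moves_def P_def[symmetric]
    by (intro order.trans[OF card_Un_le] add_mono card_image_le P)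
  then have c: "card (moves n) \<le> 3 * n\<^sup>2" using P by simp
  have "card (reachable n (Suc m) X) \<le> card (reachable n m X) + card (moves n \<times> reachable n m X)"
    unfolding reachable.simps using Suc fin
    by (intro order.trans[OF card_Un_le] add_mono card_image_le order.refl finite_cartesian_product) auto
  also have "\<dots> = (1 + card (moves n)) * card (reachable n m X)"
    by (simp add: card_cartesian_product)
  also have "\<dots> \<le> (1 + 3 * n\<^sup>2) * (1 + 3 * n\<^sup>2) ^ m"
    using Suc c by (intro mult_mono) auto
  finally show ?case using Suc fin by simp
qed

text \<open>In \<open>pair_bound\<close> only the sum \<open>w + P\<close> is known to be small; the Pluecker relation bounds
  \<open>w P\<close> and so excludes that both summands are large.\<close>

lemma summand_bound:
  fixes w P s R :: real
  assumes "\<bar>w + P\<bar> \<le> s" "\<bar>w * P\<bar> \<le> 2 * (R * s)\<^sup>2" "R \<ge> 1"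
  shows "\<bar>w\<bar> \<le> 2 * (R * s)"
proof (rule ccontr)
  assume *: "\<not> \<bar>w\<bar> \<le> 2 * (R * s)"
  have s: "0 \<le> s" using assms(1) by linarith
  then have "s \<le> R * s" using assms(3) by (simp add: mult_le_cancel_right1)
  then have P: "\<bar>P\<bar> \<ge> \<bar>w\<bar> - R * s" using assms(1) by linarith
  have "2 * (R * s)\<^sup>2 = (2 * (R * s)) * (R * s)" by (simp add: power2_eq_square)
  also have "\<dots> \<le> \<bar>w\<bar> * (R * s)" using * s assms by (intro mult_right_mono) auto
  also have "\<dots> < \<bar>w\<bar> * \<bar>P\<bar>"
  proof (rule mult_strict_left_mono)
    show "R * s < \<bar>P\<bar>" using * P by linarith
    show "0 < \<bar>w\<bar>" using * s assms(3) mult_nonneg_nonneg[of R s] by linarith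
  qed
  finally show False using assms(2) by (simp add: abs_mult)
qed

text \<open>Eliminating \<open>m'\<close> leaves (x^2 - y^2) m, bounded by (|x| + |y|) s. The factor
  |x| + |y| cancels, so only one power of the gap is lost.\<close>

lemma two_forms_bound:
  fixes x y m m' s g :: real
  assumes "\<bar>x * m + y * m'\<bar> \<le> s" "\<bar>y * m + x * m'\<bar> \<le> s" "g > 0" "g \<le> \<bar>\<bar>x\<bar> - \<bar>y\<bar>\<bar>"
  shows "\<bar>m\<bar> \<le> s / g"
proof -
  have "(x\<^sup>2 - y\<^sup>2) * m = x * (x * m + y * m') - y * (y * m + x * m')"
    by (simp add: power2_eq_square algebra_simps)
  then have "\<bar>(x\<^sup>2 - y\<^sup>2) * m\<bar> \<le> \<bar>x * (x * m + y * m')\<bar> + \<bar>y * (y * m + x * m')\<bar>"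
    by linarith
  also have "\<dots> \<le> \<bar>x\<bar> * s + \<bar>y\<bar> * s"
    unfolding abs_mult using assms by (intro add_mono mult_left_mono) auto
  also have "\<bar>(x\<^sup>2 - y\<^sup>2) * m\<bar> = (\<bar>x\<bar> + \<bar>y\<bar>) * (\<bar>\<bar>x\<bar> - \<bar>y\<bar>\<bar> * \<bar>m\<bar>)"
  proof -
    have "x\<^sup>2 - y\<^sup>2 = (\<bar>x\<bar> + \<bar>y\<bar>) * (\<bar>x\<bar> - \<bar>y\<bar>)"
      by (simp add: algebra_simps power2_eq_square)
    then show ?thesis by (simp add: abs_mult)
  qed
  finally have "(\<bar>x\<bar> + \<bar>y\<bar>) * (\<bar>\<bar>x\<bar> - \<bar>y\<bar>\<bar> * \<bar>m\<bar>) \<le> (\<bar>x\<bar> + \<bar>y\<bar>) * s"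
    by (simp add: algebra_simps)
  moreover have "\<bar>x\<bar> + \<bar>y\<bar> > 0" using assms(3,4) by linarith
  ultimately have "\<bar>\<bar>x\<bar> - \<bar>y\<bar>\<bar> * \<bar>m\<bar> \<le> s" by simp
  moreover have "g * \<bar>m\<bar> \<le> \<bar>\<bar>x\<bar> - \<bar>y\<bar>\<bar> * \<bar>m\<bar>" using assms by (intro mult_right_mono) auto
  ultimately show ?thesis using assms by (simp add: field_simps)
qed

text \<open>As a bilinear form in rows \<open>p\<close> and \<open>q\<close>, the determinant is
  \<open>w0 + x p * x q * w2\<close> plus a combination of the mixed forms \<open>m\<close>.
  Flipping both signs separates the two parts, swapping the entries gives a second equation for the
  same mixed forms, and a quarter turn exchanges \<open>m p q\<close>, \<open>m q p\<close> for
  \<open>m p p\<close>, \<open>m q q\<close>. This takes at most 2 + 1 + 1 = 4 moves. The gap is one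
  of absolute values because the lemma is also applied to negated entries.\<close>

lemma pair_bound:
  fixes x :: "nat \<Rightarrow> real" and u :: "nat \<Rightarrow> nat \<Rightarrow> real"
  assumes pq: "p < n" "q < n" "p \<noteq> q"
    and K: "\<bar>x p\<bar> \<le> K" "\<bar>x q\<bar> \<le> K"
    and g: "0 < g" "g \<le> \<bar>\<bar>x p\<bar> - \<bar>x q\<bar>\<bar>" "g \<le> K"
    and s: "\<And>Y. Y \<in> reachable n 4 (diag_fun x) \<Longrightarrow> \<bar>sum_det n Y u\<bar> \<le> s"
  defines "r \<equiv> \<lambda>i j. diag_fun x i j + u i j"
  shows "a \<in> {p,q} \<Longrightarrow> b \<in> {p,q} \<Longrightarrow> \<bar>rdet2 n r p q (unit_fun a) (u b)\<bar> \<le> s / g"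
    and "\<bar>rdet2 n r p q (u p) (u q)\<bar> \<le> 2 * (K / g * s)"
proof -
  define R where "R = rdet2 n r p q"
  define w0 where "w0 = R (u p) (u q)"
  define w2 where "w2 = R (unit_fun p) (unit_fun q)"
  define m where "m = (\<lambda>a b. R (unit_fun a) (u b))"
  have rev: "R (u b) (unit_fun a) = - m a b" for a b
    unfolding m_def R_def by (rule rdet2_swap[OF pq])
  have sw: "R (unit_fun q) (unit_fun p) = - w2" unfolding w2_def R_def by (rule rdet2_swap[OF pq])
  note lin = rdet2_add_right[OF pq(2)] rdet2_add_left[OF pq(1,3)]
    rdet2_scale_right[OF pq(2)] rdet2_scale_left[OF pq(1,3)]
  have diag: "sum_det n (diag_fun y) u = (w0 + y p * y q * w2) + (y p * m p q - y q * m q p)"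
    if "\<And>i. i \<noteq> p \<Longrightarrow> i \<noteq> q \<Longrightarrow> y i = x i" for y
  proof -
    have "sum_det n (diag_fun y) u = R (\<lambda>j. y p * unit_fun p j + u p j) (\<lambda>j. y q * unit_fun q j + u q j)"
      unfolding sum_det_def R_def rdet2_def r_def
      by (rule rdet_cong) (use that pq in \<open>auto simp: diag_fun_def unit_fun_def\<close>)
    also have "\<dots> = (w0 + y p * y q * w2) + (y p * m p q - y q * m q p)"
      using rev[of p q] rev[of q p]
      unfolding R_def lin w0_def w2_def m_def by (simp add: algebra_simps)
    finally show ?thesis .
  qed
  have quarter: "sum_det n (rotate_rows p q 0 1 (diag_fun y)) u
      = (w0 + y p * y q * w2) + (y q * m q q + y p * m p p)"
    if "\<And>i. i \<noteq> p \<Longrightarrow> i \<noteq> q \<Longrightarrow> y i = x i" for y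
  proof -
    have "sum_det n (rotate_rows p q 0 1 (diag_fun y)) u
        = R (\<lambda>j. y q * unit_fun q j + u p j) (\<lambda>j. - y p * unit_fun p j + u q j)"
      unfolding sum_det_def R_def rdet2_def r_def
      by (rule rdet_cong) (use that pq in \<open>auto simp: rotate_rows_def diag_fun_def unit_fun_def\<close>)
    also have "\<dots> = (w0 + y p * y q * w2) + (y q * m q q + y p * m p p)"
      using rev[of p p] sw
      unfolding R_def lin w0_def w2_def m_def by (simp add: algebra_simps)
    finally show ?thesis .
  qed
  \<comment> \<open>The swap preserves \<open>x p * x q\<close>. It therefore yields new equations
    for the mixed forms but cannot separate \<open>w0\<close> from \<open>w2\<close>, which is left
    to the Pluecker relation.\<close>
  define xs where "xs = x(p := x q, q := x p)"
  have xs: "xs p = x q" "xs q = x p" "\<And>i. i \<noteq> p \<Longrightarrow> i \<noteq> q \<Longrightarrow> xs i = x i"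
    using pq by (auto simp: xs_def)
  have sbound: "\<bar>(w0 + y p * y q * w2) + (y p * m p q - y q * m q p)\<bar> \<le> s \<and>
      \<bar>(w0 + y p * y q * w2) - (y p * m p q - y q * m q p)\<bar> \<le> s \<and>
      \<bar>(w0 + y p * y q * w2) + (y q * m q q + y p * m p p)\<bar> \<le> s \<and>
      \<bar>(w0 + y p * y q * w2) - (y q * m q q + y p * m p p)\<bar> \<le> s"
    if y: "diag_fun y \<in> reachable n 2 (diag_fun x)" "\<And>i. i \<noteq> p \<Longrightarrow> i \<noteq> q \<Longrightarrow> y i = x i" for y
  proof -
    define z where "z = y(p := - y p, q := - y q)"
    have z: "z p = - y p" "z q = - y q" "\<And>i. i \<noteq> p \<Longrightarrow> i \<noteq> q \<Longrightarrow> z i = x i"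
      using pq y by (auto simp: z_def)
    have "diag_fun z \<in> reachable n 3 (diag_fun x)"
      using reachable_trans[OF reachable_neg[OF pq, of y] y(1)] by (simp add: z_def)
    moreover have "diag_fun y \<in> reachable n 3 (diag_fun x)" using y(1) reachable_mono[of 2 3] by simp
    moreover have "Y \<in> reachable n 3 (diag_fun x) \<Longrightarrow> Y \<in> reachable n 4 (diag_fun x) \<and> rotate_rows p q 0 1 Y \<in> reachable n 4 (diag_fun x)" for Y
      using reachable_mono[of 3 4 Y n "diag_fun x"] reachable_trans[OF reachable_quarter[OF pq, of Y], of 3 "diag_fun x"] by simp
    ultimately have "\<bar>sum_det n (diag_fun y) u\<bar> \<le> s" "\<bar>sum_det n (diag_fun z) u\<bar> \<le> s"
      "\<bar>sum_det n (rotate_rows p q 0 1 (diag_fun y)) u\<bar> \<le> s" "\<bar>sum_det n (rotate_rows p q 0 1 (diag_fun z)) u\<bar> \<le> s"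
      using s by blast+
    then show ?thesis
      using diag[of y] diag[of z] quarter[of y] quarter[of z] y(2) z by (simp add: algebra_simps)
  qed
  note b1 = sbound[of x, OF reachable_self] and
    b2 = sbound[of xs, unfolded xs(1,2), OF _ xs(3)]
  have "diag_fun xs \<in> reachable n 2 (diag_fun x)" unfolding xs_def by (rule reachable_swap[OF pq])
  note b2 = b2[OF this]
  have base: "\<bar>w0 + x p * x q * w2\<bar> \<le> s" using b1 by (simp add: abs_if split: if_splits)
  have f1: "\<bar>x p * m p q + x q * (- m q p)\<bar> \<le> s" "\<bar>x p * m p p + x q * m q q\<bar> \<le> s"
    using b1 by (simp_all add: abs_if split: if_splits)
  have f2: "\<bar>x q * m p q + x p * (- m q p)\<bar> \<le> s" "\<bar>x q * m p p + x p * m q q\<bar> \<le> s"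
    using b2 by (simp_all add: abs_if split: if_splits)
  have g': "g \<le> \<bar>\<bar>x q\<bar> - \<bar>x p\<bar>\<bar>" using g(2) by linarith
  have f3: "\<bar>x q * (- m q p) + x p * m p q\<bar> \<le> s" "\<bar>x q * m q q + x p * m p p\<bar> \<le> s"
    using f1 by (simp_all add: add.commute)
  have f4: "\<bar>x p * (- m q p) + x q * m p q\<bar> \<le> s" "\<bar>x p * m q q + x q * m p p\<bar> \<le> s"
    using f2 by (simp_all add: add.commute)
  have m_bound: "\<bar>m p q\<bar> \<le> s / g" "\<bar>m q p\<bar> \<le> s / g" "\<bar>m p p\<bar> \<le> s / g" "\<bar>m q q\<bar> \<le> s / g"
    using two_forms_bound[OF f1(1) f2(1) g(1,2)] two_forms_bound[OF f1(2) f2(2) g(1,2)]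
      two_forms_bound[OF f3(1) f4(1) g(1) g'] two_forms_bound[OF f3(2) f4(2) g(1) g']
    by simp_all
  then show "a \<in> {p,q} \<Longrightarrow> b \<in> {p,q} \<Longrightarrow> \<bar>rdet2 n r p q (unit_fun a) (u b)\<bar> \<le> s / g"
    by (auto simp: m_def R_def)
  have "w0 * w2 = m p p * m q q - m p q * m q p"
    unfolding w0_def w2_def m_def R_def by (rule rdet2_plucker[OF pq])
  then have "\<bar>w0 * w2\<bar> \<le> \<bar>m p p\<bar> * \<bar>m q q\<bar> + \<bar>m p q\<bar> * \<bar>m q p\<bar>"
    unfolding abs_mult[symmetric] by linarith
  also have "\<dots> \<le> s / g * (s / g) + s / g * (s / g)"
    using m_bound by (intro add_mono mult_mono') auto
  finally have w: "\<bar>w0 * w2\<bar> \<le> 2 * (s / g)\<^sup>2" by (simp add: power2_eq_square)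
  have "\<bar>w0 * (x p * x q * w2)\<bar> = \<bar>x p\<bar> * \<bar>x q\<bar> * \<bar>w0 * w2\<bar>"
    by (simp add: abs_mult)
  also have "\<dots> \<le> K * K * (2 * (s / g)\<^sup>2)"
    using K w by (intro mult_mono) auto
  also have "\<dots> = 2 * (K / g * s)\<^sup>2" by (simp add: power2_eq_square)
  finally show "\<bar>rdet2 n r p q (u p) (u q)\<bar> \<le> 2 * (K / g * s)"
    using summand_bound[OF base, of "K / g"] g by (simp add: w0_def R_def)
qed

text \<open>Expanding the rows that still carry a diagonal entry reduces the numerator to the forms
  in \<open>pair_bound\<close>. The gap of 4 g provides an index \<open>i\<close> with
  \<open>d i\<close> at distance 2 g from \<open>d j\<close>, hence at distance g from
  \<open>d k\<close> whenever \<open>d k\<close> is within g of \<open>d j\<close>. The seven moves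
  are three that bring \<open>d i\<close>, with either sign, to position \<open>j\<close>, and four
  inside \<open>pair_bound\<close>.\<close>

lemma numerator_bound:
  fixes d :: "nat \<Rightarrow> real" and u :: "nat \<Rightarrow> nat \<Rightarrow> real"
  assumes d: "\<And>i. i < n \<Longrightarrow> 0 \<le> d i \<and> d i \<le> K"
    and g: "0 < g" "g \<le> K"
    and gap: "p < n" "q < n" "\<bar>d p - d q\<bar> \<ge> 4 * g"
    and s: "\<And>Y. Y \<in> reachable n 7 (diag_fun d) \<Longrightarrow> \<bar>sum_det n Y u\<bar> \<le> s"
    and jk: "j < n" "k < n"
  shows "\<bar>rdet n ((\<lambda>i j. diag_fun d i j + u i j)(k := u j))\<bar> \<le> 3 * K / g * s"
proof -
  define r where "r = (\<lambda>i j. diag_fun d i j + u i j)"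
  have r_row: "r i = (\<lambda>l. d i * unit_fun i l + u i l)" for i
    by (auto simp: r_def diag_fun_def unit_fun_def)
  have s0: "0 \<le> s" using s[OF reachable_self] by linarith
  have s4: "\<bar>sum_det n Y u\<bar> \<le> s" if "Y \<in> reachable n 4 (diag_fun d)" for Y
    using s reachable_mono[of 4 7 Y] that by simp
  have dK: "\<bar>d i\<bar> \<le> K" if "i < n" for i using d[OF that] by simp
  obtain i where i: "i < n" "\<bar>d i - d j\<bar> \<ge> 2 * g"
  proof (cases "\<bar>d p - d j\<bar> \<ge> 2 * g")
    case False
    then have "\<bar>d q - d j\<bar> \<ge> 2 * g" using gap by linarith
    then show ?thesis using that gap by blast
  qed (use that gap in blast)
  consider "j = k" | "j \<noteq> k" "\<bar>d j - d k\<bar> \<ge> g" | "j \<noteq> k" "\<bar>d j - d k\<bar> < g" by linarith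
  then have "\<bar>rdet n (r(k := u j))\<bar> \<le> 3 * K / g * s"
  proof cases
    \<comment> \<open>Row \<open>j\<close> has lost its diagonal entry, so the pair is completed by
      row \<open>i\<close>. One mixed form and one form in two rows of \<open>u\<close> occur, which
      gives 3 = 1 + 2.\<close>
    case 1
    have ij: "j < n" "i < n" "j \<noteq> i" using i g jk by auto
    have "g \<le> \<bar>\<bar>d j\<bar> - \<bar>d i\<bar>\<bar>" using i g d[OF ij(1)] d[OF ij(2)] by simp
    note pb = pair_bound[OF ij dK[OF ij(1)] dK[OF ij(2)] g(1) this g(2) s4, folded r_def]
    have "rdet n (r(k := u j)) = rdet2 n r j i (u j) (r i)"
      using 1 ij by (simp add: rdet2_def fun_upd_twist)
    also have "\<dots> = d i * rdet2 n r j i (u j) (unit_fun i) + rdet2 n r j i (u j) (u i)"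
      unfolding r_row by (simp only: rdet2_add_right[OF ij(2)] rdet2_scale_right[OF ij(2)])
    finally have "\<bar>rdet n (r(k := u j))\<bar> \<le> \<bar>d i\<bar> * \<bar>rdet2 n r j i (unit_fun i) (u j)\<bar> + \<bar>rdet2 n r j i (u j) (u i)\<bar>"
      using abs_triangle_ineq[of "d i * rdet2 n r j i (u j) (unit_fun i)"]
      by (simp add: abs_mult rdet2_swap[OF ij, of r "unit_fun i" "u j"])
    also have "\<dots> \<le> K * (s / g) + 2 * (K / g * s)"
    proof (intro add_mono mult_mono)
      show "\<bar>rdet2 n r j i (unit_fun i) (u j)\<bar> \<le> s / g" by (rule pb(1)) auto
      show "\<bar>rdet2 n r j i (u j) (u i)\<bar> \<le> 2 * (K / g * s)" by (rule pb(2))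
    qed (use dK[OF ij(2)] g in auto)
    finally show ?thesis by (simp add: field_simps)
  next
    case 2
    note jk' = jk 2(1)
    have "g \<le> \<bar>\<bar>d j\<bar> - \<bar>d k\<bar>\<bar>" using 2 d[OF jk(1)] d[OF jk(2)] by simp
    note pb = pair_bound(1)[OF jk' dK[OF jk(1)] dK[OF jk(2)] g(1) this g(2) s4, folded r_def]
    \<comment> \<open>Row \<open>j\<close> is still \<open>d j\<close> times a unit vector plus
      \<open>u j\<close>; the second part equals the new row \<open>k\<close> and drops out.\<close>
    have "rdet n (r(k := u j)) = rdet2 n r j k (r j) (u j)"
      by (simp add: rdet2_def)
    also have "\<dots> = d j * rdet2 n r j k (unit_fun j) (u j)"
      unfolding r_row
      by (simp only: rdet2_add_left[OF jk'(1,3)] rdet2_scale_left[OF jk'(1,3)] rdet2_same[OF jk']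
          add_0_right)
    finally have "\<bar>rdet n (r(k := u j))\<bar> = \<bar>d j\<bar> * \<bar>rdet2 n r j k (unit_fun j) (u j)\<bar>"
      by (simp add: abs_mult)
    also have "\<dots> \<le> K * (s / g)"
    proof (intro mult_mono)
      show "\<bar>rdet2 n r j k (unit_fun j) (u j)\<bar> \<le> s / g" by (rule pb) auto
    qed (use dK[OF jk(1)] g in auto)
    also have "\<dots> \<le> 3 * K / g * s" using s0 g by (simp add: field_simps)
    finally show ?thesis .
  next
    \<comment> \<open>\<open>d j\<close> and \<open>d k\<close> are too close for
      \<open>pair_bound\<close>. Exchanging \<open>d i\<close> and \<open>d j\<close> opens a gap
      between positions \<open>j\<close> and \<open>k\<close>, at the price of changing row
      \<open>i\<close>. Doing this with both signs separates the two contributions of row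
      \<open>i\<close>. The product \<open>d j * E1\<close> is kept together because
      \<open>d j\<close> may vanish; this is enough, since the numerator is
      \<open>d i * (d j * E1) + d j * E0\<close>.\<close>
    case 3
    note jk' = jk 3(1)
    have gik: "g \<le> \<bar>d i - d k\<bar>" using i 3 by linarith
    then have ne: "i \<noteq> j" "i \<noteq> k" using i g by auto
    define base where "base = r(j := unit_fun j, k := u j)"
    define E0 where "E0 = rdet n (base(i := u i))"
    define E1 where "E1 = rdet n (base(i := unit_fun i))"
    have E: "rdet n (base(i := \<lambda>l. c * unit_fun i l + u i l)) = c * E1 + E0" for c
      using rdet_row_linear[OF i(1), of base c "unit_fun i" 1 "u i"] by (simp add: E0_def E1_def)
    have key: "\<bar>e * d j * E1 + E0\<bar> \<le> s / g"
      if e: "\<bar>e\<bar> = 1" and reachable: "diag_fun (d(i := e * d j, j := e * d i)) \<in> reachable n 3 (diag_fun d)" for e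
    proof -
      let ?x = "d(i := e * d j, j := e * d i)"
      have x: "\<bar>?x j\<bar> = \<bar>d i\<bar>" "\<bar>?x k\<bar> = \<bar>d k\<bar>" using ne 3 e by (auto simp: abs_mult)
      have "g \<le> \<bar>\<bar>?x j\<bar> - \<bar>?x k\<bar>\<bar>" unfolding x using gik d[OF i(1)] d[OF jk(2)] by simp
      note pb = pair_bound(1)[OF jk', of ?x K g u s j j, unfolded x,
          OF dK[OF i(1)] dK[OF jk(2)] g(1) this[unfolded x] g(2)]
      have "\<bar>rdet2 n (\<lambda>i' l. diag_fun ?x i' l + u i' l) j k (unit_fun j) (u j)\<bar> \<le> s / g"
        by (rule pb) (use s reachable_trans[OF _ reachable, of _ 4] in auto)
      also have "rdet2 n (\<lambda>i' l. diag_fun ?x i' l + u i' l) j k (unit_fun j) (u j)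
          = rdet n (base(i := \<lambda>l. (e * d j) * unit_fun i l + u i l))"
        unfolding rdet2_def base_def r_def
        by (rule rdet_cong) (use ne 3 in \<open>auto simp: diag_fun_def unit_fun_def\<close>)
      finally show ?thesis unfolding E by simp
    qed
    have sw: "diag_fun (d(i := d j, j := d i)) \<in> reachable n 2 (diag_fun d)"
      by (rule reachable_swap[OF i(1) jk(1) ne(1)])
    have "diag_fun ((d(i := d j, j := d i))(i := - d j, j := - d i)) \<in> reachable n 3 (diag_fun d)"
      using reachable_trans[OF reachable_neg[OF i(1) jk(1) ne(1), of "d(i := d j, j := d i)"] sw] ne by simp
    moreover have "(d(i := d j, j := d i))(i := - d j, j := - d i) = d(i := - d j, j := - d i)"
      using ne by (auto simp: fun_eq_iff)
    ultimately have "\<bar>d j * E1 + E0\<bar> \<le> s / g" "\<bar>- d j * E1 + E0\<bar> \<le> s / g"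
      using key[of 1] key[of "- 1"] sw reachable_mono[of 2 3] by simp_all
    then have b: "\<bar>E0\<bar> \<le> s / g" "\<bar>d j * E1\<bar> \<le> s / g" by linarith+
    have "rdet n (r(k := u j)) = rdet2 n r j k (r j) (u j)"
      by (simp add: rdet2_def)
    also have "\<dots> = d j * rdet2 n r j k (unit_fun j) (u j)"
      unfolding r_row
      by (simp only: rdet2_add_left[OF jk'(1,3)] rdet2_scale_left[OF jk'(1,3)] rdet2_same[OF jk']
          add_0_right)
    also have "rdet2 n r j k (unit_fun j) (u j) = rdet n (base(i := \<lambda>l. d i * unit_fun i l + u i l))"
      unfolding rdet2_def base_def r_def
      by (rule rdet_cong) (use ne 3 in \<open>auto simp: diag_fun_def unit_fun_def\<close>)
    also have "d j * \<dots> = d i * (d j * E1) + d j * E0"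
      unfolding E by (simp add: algebra_simps)
    finally have "\<bar>rdet n (r(k := u j))\<bar> \<le> \<bar>d i\<bar> * \<bar>d j * E1\<bar> + \<bar>d j\<bar> * \<bar>E0\<bar>"
      using abs_triangle_ineq[of "d i * (d j * E1)" "d j * E0"] by (simp only: abs_mult)
    also have "\<dots> \<le> K * (s / g) + K * (s / g)"
      using b dK[OF i(1)] dK[OF jk(1)] s0 by (intro add_mono mult_mono) auto
    also have "\<dots> \<le> 3 * K / g * s" using s0 g by (simp add: field_simps)
    finally show ?thesis .
  qed
  then show ?thesis unfolding r_def .
qed

subsection \<open>Anti-concentration on a grid of rotations\<close>

text \<open>Divided differences, with 1/M as a lower bound for the distances of the nodes. The first
  ones are at most 2 M \<eta>, so the second, which is \<open>z\<close>, is at most 4 M^2 \<eta>.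
  Then \<open>y\<close> and \<open>x\<close> cost 10 and 15 times M^2 \<eta>, and 4 + 10 + 15 is
  below 30.\<close>

lemma quadratic_coeff_bound:
  fixes x y z a b c \<eta> M :: real
  assumes "0 \<le> a" "a \<le> 1" "0 \<le> b" "b \<le> 1" "0 \<le> c" "c \<le> 1"
    and sep: "1 \<le> M * \<bar>a - b\<bar>" "1 \<le> M * \<bar>b - c\<bar>" "1 \<le> M * \<bar>a - c\<bar>"
    and M: "1 \<le> M"
    and p: "\<bar>x + y * a + z * a\<^sup>2\<bar> \<le> \<eta>" "\<bar>x + y * b + z * b\<^sup>2\<bar> \<le> \<eta>" "\<bar>x + y * c + z * c\<^sup>2\<bar> \<le> \<eta>"
  shows "\<bar>x\<bar> + \<bar>y\<bar> + \<bar>z\<bar> \<le> 30 * M\<^sup>2 * \<eta>"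
proof -
  have \<eta>: "0 \<le> \<eta>" using p(1) by linarith
  have div: "\<bar>v\<bar> \<le> M * e" if "\<bar>v * h\<bar> \<le> e" "1 \<le> M * \<bar>h\<bar>" for v h e :: real
  proof -
    have "\<bar>v\<bar> * 1 \<le> \<bar>v\<bar> * (M * \<bar>h\<bar>)" using that by (intro mult_left_mono) auto
    also have "\<dots> = M * \<bar>v * h\<bar>" by (simp add: abs_mult)
    also have "\<dots> \<le> M * e" using that M by (intro mult_left_mono) auto
    finally show ?thesis by simp
  qed
  have "(y + z * (a + b)) * (a - b) = (x + y * a + z * a\<^sup>2) - (x + y * b + z * b\<^sup>2)"
    "(y + z * (b + c)) * (b - c) = (x + y * b + z * b\<^sup>2) - (x + y * c + z * c\<^sup>2)"
    by (simp_all add: power2_eq_square algebra_simps)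
  then have "\<bar>(y + z * (a + b)) * (a - b)\<bar> \<le> 2 * \<eta>" "\<bar>(y + z * (b + c)) * (b - c)\<bar> \<le> 2 * \<eta>"
    using p by linarith+
  then have d: "\<bar>y + z * (a + b)\<bar> \<le> M * (2 * \<eta>)" "\<bar>y + z * (b + c)\<bar> \<le> M * (2 * \<eta>)"
    using div sep by blast+
  have "z * (a - c) = (y + z * (a + b)) - (y + z * (b + c))" by (simp add: algebra_simps)
  then have "\<bar>z * (a - c)\<bar> \<le> 4 * M * \<eta>" using d by linarith
  then have "\<bar>z\<bar> \<le> M * (4 * M * \<eta>)" using div sep by blast
  then have z: "\<bar>z\<bar> \<le> 4 * (M\<^sup>2 * \<eta>)" by (simp add: power2_eq_square)
  have "M * \<eta> \<le> M * M * \<eta>" "\<eta> \<le> M * M * \<eta>"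
    using M \<eta> mult_mono[of 1 M 1 M] by (auto intro!: mult_right_mono simp: mult_le_cancel_right1)
  then have e: "M * \<eta> \<le> M\<^sup>2 * \<eta>" "\<eta> \<le> M\<^sup>2 * \<eta>" by (simp_all add: power2_eq_square)
  have "\<bar>z * (a + b)\<bar> \<le> \<bar>z\<bar> * 2"
    unfolding abs_mult using assms by (intro mult_left_mono) auto
  then have y: "\<bar>y\<bar> \<le> 10 * (M\<^sup>2 * \<eta>)" using d(1) z e by linarith
  have "\<bar>y * a\<bar> \<le> \<bar>y\<bar> * 1" "\<bar>z * a\<^sup>2\<bar> \<le> \<bar>z\<bar> * 1"
    unfolding abs_mult using assms by (auto intro!: mult_left_le power_le_one)
  then have "\<bar>x\<bar> \<le> 15 * (M\<^sup>2 * \<eta>)" using p(1) z y e by linarith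
  then show ?thesis using y z e \<eta> by linarith
qed

text \<open>The rational parametrisation of the circle, with j/N as the tangent of the half angle.
  It makes an affine function of cosine and sine a quadratic polynomial in j/N over a positive
  denominator, and averaging over the rotations becomes a finite sum.\<close>

definition grid_cos :: "nat \<Rightarrow> nat \<Rightarrow> real" where
  "grid_cos N j = (1 - (j / N)\<^sup>2) / (1 + (j / N)\<^sup>2)"

definition grid_sin :: "nat \<Rightarrow> nat \<Rightarrow> real" where
  "grid_sin N j = 2 * (j / N) / (1 + (j / N)\<^sup>2)"

lemma grid_cos_sin: "(grid_cos N j)\<^sup>2 + (grid_sin N j)\<^sup>2 = 1"
proof -
  define s where "s = real j / real N"
  have nz: "1 + s\<^sup>2 \<noteq> 0" using zero_le_power2[of s] by linarith
  have "(grid_cos N j)\<^sup>2 + (grid_sin N j)\<^sup>2 = ((1 - s\<^sup>2)\<^sup>2 + (2 * s)\<^sup>2) / (1 + s\<^sup>2)\<^sup>2"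
    by (simp add: grid_cos_def grid_sin_def s_def[symmetric] power_divide add_divide_distrib)
  also have "(1 - s\<^sup>2)\<^sup>2 + (2 * s)\<^sup>2 = (1 + s\<^sup>2)\<^sup>2"
    by (simp add: power2_eq_square algebra_simps)
  finally show ?thesis using nz by simp
qed

lemma card_le_2_if_no_triple:
  assumes "finite S" "\<And>a b c. a \<in> S \<Longrightarrow> b \<in> S \<Longrightarrow> c \<in> S \<Longrightarrow> a \<noteq> b \<Longrightarrow> b \<noteq> c \<Longrightarrow> a \<noteq> c \<Longrightarrow> False"
  shows "card S \<le> 2"
proof (rule ccontr)
  assume "\<not> card S \<le> 2"
  then obtain T where "T \<subseteq> S" "card T = 3"
    using obtain_subset_with_card_n[of 3 S] by (metis not_less_eq_eq numeral_2_eq_2 numeral_3_eq_3)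
  then obtain a b c where "T = {a,b,c}" "a \<noteq> b" "a \<noteq> c" "b \<noteq> c"
    unfolding card_3_iff by blast
  then show False using assms(2)[of a b c] \<open>T \<subseteq> S\<close> by auto
qed

text \<open>Multiplication by 1 + (j/N)^2, which is at most 2, leaves a quadratic polynomial in j/N.
  Three bad nodes, at distances at least 1/N, would bound the sum of its coefficients by 30/100 of
  \<open>H\<close>. But \<open>H\<close> is at most that sum, so it would vanish, whereas a bad node
  forces \<open>H > 0\<close>. In the application \<open>\<beta>'\<close> is the value of the same
  affine function at another angle.\<close>

lemma grid_bad_card:
  fixes \<alpha> \<beta> \<gamma> :: real
  assumes N: "N > 0"
    and bd: "\<And>j. \<bar>\<beta>' j\<bar> \<le> \<bar>\<alpha>\<bar> + \<bar>\<beta>\<bar> + \<bar>\<gamma>\<bar>"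
  shows "card {j. j < N \<and>
    200 * (real N)\<^sup>2 * \<bar>\<alpha> + \<beta> * grid_cos N j + \<gamma> * grid_sin N j\<bar> < \<bar>\<beta>' j\<bar>} \<le> 2"
    (is "card {j. j < N \<and> ?bad j} \<le> 2")
proof (rule card_le_2_if_no_triple)
  define H where "H = \<bar>\<alpha>\<bar> + \<bar>\<beta>\<bar> + \<bar>\<gamma>\<bar>"
  have N2: "(real N)\<^sup>2 > 0" using N by simp
  have val: "\<bar>(\<alpha> + \<beta>) + (2 * \<gamma>) * (j / N) + (\<alpha> - \<beta>) * (j / N)\<^sup>2\<bar> \<le> H / (100 * (real N)\<^sup>2)
      \<and> H > 0" if "j < N" "?bad j" for j
  proof -
    define s where "s = real j / real N"
    have s: "0 \<le> s" "s \<le> 1" using that by (auto simp: s_def)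
    have nz: "1 + s\<^sup>2 \<noteq> 0" using zero_le_power2[of s] by linarith
    have "(\<alpha> + \<beta>) + (2 * \<gamma>) * s + (\<alpha> - \<beta>) * s\<^sup>2
        = (1 + s\<^sup>2) * (\<alpha> + \<beta> * grid_cos N j + \<gamma> * grid_sin N j)"
    proof -
      have cs: "(1 + s\<^sup>2) * grid_cos N j = 1 - s\<^sup>2" "(1 + s\<^sup>2) * grid_sin N j = 2 * s"
        using nz by (simp_all add: grid_cos_def grid_sin_def s_def[symmetric])
      have "(1 + s\<^sup>2) * (\<alpha> + \<beta> * grid_cos N j + \<gamma> * grid_sin N j)
          = \<alpha> * (1 + s\<^sup>2) + \<beta> * ((1 + s\<^sup>2) * grid_cos N j) + \<gamma> * ((1 + s\<^sup>2) * grid_sin N j)"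
        by (simp only: distrib_left distrib_right mult_ac)
      then show ?thesis unfolding cs by (simp add: algebra_simps)
    qed
    also have "\<bar>\<dots>\<bar> \<le> 2 * \<bar>\<alpha> + \<beta> * grid_cos N j + \<gamma> * grid_sin N j\<bar>"
      unfolding abs_mult using s by (intro mult_right_mono) (auto simp: power_le_one)
    finally have 1: "\<bar>(\<alpha> + \<beta>) + (2 * \<gamma>) * s + (\<alpha> - \<beta>) * s\<^sup>2\<bar>
      \<le> 2 * \<bar>\<alpha> + \<beta> * grid_cos N j + \<gamma> * grid_sin N j\<bar>" .
    have 2: "200 * (real N)\<^sup>2 * \<bar>\<alpha> + \<beta> * grid_cos N j + \<gamma> * grid_sin N j\<bar> < H"
      using that(2) bd[of j] by (simp add: H_def)
    then have "2 * \<bar>\<alpha> + \<beta> * grid_cos N j + \<gamma> * grid_sin N j\<bar> \<le> H / (100 * (real N)\<^sup>2)"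
      using N2 by (simp add: field_simps)
    moreover have "0 \<le> 200 * (real N)\<^sup>2 * \<bar>\<alpha> + \<beta> * grid_cos N j + \<gamma> * grid_sin N j\<bar>" by simp
    ultimately show ?thesis using 1 2 unfolding s_def by linarith
  qed
  fix a b c
  assume abc: "a \<in> {j. j < N \<and> ?bad j}" "b \<in> {j. j < N \<and> ?bad j}" "c \<in> {j. j < N \<and> ?bad j}"
    "a \<noteq> b" "b \<noteq> c" "a \<noteq> c"
  have sep: "1 \<le> real N * \<bar>real i / N - real j / N\<bar>" if "i \<noteq> j" for i j
  proof -
    have "real N * \<bar>real i / N - real j / N\<bar> = \<bar>real i - real j\<bar>"
      using N by (simp add: diff_divide_distrib[symmetric] abs_divide)
    then show ?thesis using that by linarith
  qed
  have "\<bar>\<alpha> + \<beta>\<bar> + \<bar>2 * \<gamma>\<bar> + \<bar>\<alpha> - \<beta>\<bar> \<le> 30 * (real N)\<^sup>2 * (H / (100 * (real N)\<^sup>2))"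
  proof (rule quadratic_coeff_bound)
    show "\<bar>(\<alpha> + \<beta>) + (2 * \<gamma>) * (a / N) + (\<alpha> - \<beta>) * (a / N)\<^sup>2\<bar> \<le> H / (100 * (real N)\<^sup>2)"
      "\<bar>(\<alpha> + \<beta>) + (2 * \<gamma>) * (b / N) + (\<alpha> - \<beta>) * (b / N)\<^sup>2\<bar> \<le> H / (100 * (real N)\<^sup>2)"
      "\<bar>(\<alpha> + \<beta>) + (2 * \<gamma>) * (c / N) + (\<alpha> - \<beta>) * (c / N)\<^sup>2\<bar> \<le> H / (100 * (real N)\<^sup>2)"
      using abc(1-3) val by blast+
    show "a / N \<le> 1" "b / N \<le> 1" "c / N \<le> 1" using abc(1-3) by simp_all
    show "1 \<le> real N" using N by simp
  qed (use sep abc(4-6) in simp_all)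
  also have "\<dots> = 30 / 100 * H" using N2 by simp
  finally have "\<bar>\<alpha> + \<beta>\<bar> + \<bar>2 * \<gamma>\<bar> + \<bar>\<alpha> - \<beta>\<bar> \<le> 30 / 100 * H" .
  moreover have "2 * \<bar>\<alpha>\<bar> \<le> \<bar>\<alpha> + \<beta>\<bar> + \<bar>\<alpha> - \<beta>\<bar>" "2 * \<bar>\<beta>\<bar> \<le> \<bar>\<alpha> + \<beta>\<bar> + \<bar>\<alpha> - \<beta>\<bar>"
    "\<bar>2 * \<gamma>\<bar> = 2 * \<bar>\<gamma>\<bar>"
    by linarith+
  moreover have "H = \<bar>\<alpha>\<bar> + \<bar>\<beta>\<bar> + \<bar>\<gamma>\<bar>" "0 \<le> \<bar>\<gamma>\<bar>" by (simp_all add: H_def)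
  ultimately have "H \<le> 0" by linarith
  moreover have "H > 0" using val[of a] abc(1) by blast
  ultimately show False by simp
qed simp

section \<open>Plane rotations as elements of the orthogonal group\<close>

definition rotation_mat :: "nat \<Rightarrow> nat \<Rightarrow> nat \<Rightarrow> real \<Rightarrow> real \<Rightarrow> real Matrix.mat" where
  "rotation_mat n p q a b = Matrix.mat n n (\<lambda>(i,j). rotate_rows p q a b (diag_fun (\<lambda>_. 1)) i j)"

lemma rotation_mat_carrier [simp]: "rotation_mat n p q a b \<in> carrier_mat n n"
  by (simp add: rotation_mat_def)

lemma rotation_mat_mult_index:
  assumes pq: "p < n" "q < n" "p \<noteq> q" and U: "U \<in> carrier_mat n m" and ij: "i < n" "j < m"
  shows "(rotation_mat n p q a b * U) $$ (i,j) = rotate_rows p q a b (\<lambda>k l. U $$ (k,l)) i j"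
proof -
  have "(rotation_mat n p q a b * U) $$ (i,j)
      = (\<Sum>k<n. rotate_rows p q a b (diag_fun (\<lambda>_. 1)) i k * U $$ (k,j))"
    using U ij by (auto simp: rotation_mat_def scalar_prod_def atLeast0LessThan intro!: sum.cong)
  also have "\<dots> = rotate_rows p q a b (\<lambda>k l. U $$ (k,l)) i j"
  proof -
    have two: "(\<Sum>k<n. (c * (if p' = k then 1 else 0) + d * (if q' = k then 1 else 0)) * U $$ (k,j))
        = c * U $$ (p',j) + d * U $$ (q',j)" if "p' < n" "q' < n" for c d :: real and p' q'
    proof -
      have "(\<Sum>k<n. (c * (if p' = k then 1 else 0) + d * (if q' = k then 1 else 0)) * U $$ (k,j))
          = (\<Sum>k<n. if p' = k then c * U $$ (k,j) else 0) + (\<Sum>k<n. if q' = k then d * U $$ (k,j) else 0)"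
        unfolding sum.distrib[symmetric] by (intro sum.cong refl) (simp add: algebra_simps)
      then show ?thesis using that by simp
    qed
    have one: "(\<Sum>k<n. (if i = k then 1 else 0) * U $$ (k,j)) = U $$ (i,j)"
      using two[of i i 1 0] ij by simp
    show ?thesis
      using two[of p q a b] two[of q p a "- b"] one pq ij by (simp add: rotate_rows_def diag_fun_def)
  qed
  finally show ?thesis .
qed

lemma rotation_mat_orthogonal:
  assumes pq: "p < n" "q < n" "p \<noteq> q" and ab: "a\<^sup>2 + b\<^sup>2 = 1"
  shows "rotation_mat n p q a b \<in> orthogonal_group n"
proof -
  have tr: "transpose_mat (rotation_mat n p q a b) = rotation_mat n p q a (- b)"
    unfolding rotation_mat_def using pq by (intro eq_matI) (auto simp: rotate_rows_def diag_fun_def)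
  have "rotation_mat n p q a (- b) * rotation_mat n p q a b = 1\<^sub>m n"
  proof (rule eq_matI)
    fix i j assume ij: "i < dim_row (1\<^sub>m n)" "j < dim_col (1\<^sub>m n)"
    have "(rotation_mat n p q a (- b) * rotation_mat n p q a b) $$ (i,j)
        = rotate_rows p q a (- b) (\<lambda>k l. rotation_mat n p q a b $$ (k,l)) i j"
      using ij pq by (intro rotation_mat_mult_index) auto
    also have "\<dots> = rotate_rows p q a (- b) (rotate_rows p q a b (diag_fun (\<lambda>_. 1))) i j"
      using ij pq by (simp add: rotation_mat_def rotate_rows_def)
    also have "\<dots> = diag_fun (\<lambda>_. 1) i j"
      using ab rotate_rows_id by (simp add: rotate_rows_rotate_rows[OF pq(3)] power2_eq_square)
    finally show "(rotation_mat n p q a (- b) * rotation_mat n p q a b) $$ (i,j) = 1\<^sub>m n $$ (i,j)"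
      using ij by (simp add: diag_fun_def)
  qed (auto simp: rotation_mat_def)
  then show ?thesis by (simp add: orthogonal_group_def tr)
qed

subsection \<open>Haar measure on the orthogonal group\<close>

lemma orthogonal_group_transpose:
  assumes "V \<in> orthogonal_group n"
  shows "transpose_mat V \<in> orthogonal_group n"
proof -
  have V: "V \<in> carrier_mat n n" "transpose_mat V * V = 1\<^sub>m n"
    using assms by (auto simp: orthogonal_group_def)
  then have "V * transpose_mat V = 1\<^sub>m n"
    using mat_mult_left_right_inverse[of "transpose_mat V" n V] by simp
  then show ?thesis using V by (simp add: orthogonal_group_def)
qed

lemma orthogonal_group_mult:
  assumes "V \<in> orthogonal_group n" "W \<in> orthogonal_group n"
  shows "V * W \<in> orthogonal_group n"
proof -
  have c: "V \<in> carrier_mat n n" "W \<in> carrier_mat n n" "transpose_mat V * V = 1\<^sub>m n"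
    "transpose_mat W * W = 1\<^sub>m n"
    using assms by (auto simp: orthogonal_group_def)
  then have "transpose_mat (V * W) * (V * W) = transpose_mat W * (transpose_mat V * (V * W))"
    using assoc_mult_mat[of "transpose_mat W" n n "transpose_mat V" n "V * W" n]
    by (simp add: transpose_mult[of V n n W n])
  also have "transpose_mat V * (V * W) = W"
    using c assoc_mult_mat[of "transpose_mat V" n n V n W n] by simp
  finally show ?thesis using c by (simp add: orthogonal_group_def)
qed

lemma orthogonal_group_carrier: "V \<in> orthogonal_group n \<Longrightarrow> V \<in> carrier_mat n n"
  by (simp add: orthogonal_group_def)

lemma borel_measurable_rdet:
  assumes "\<And>i j. i < n \<Longrightarrow> j < n \<Longrightarrow> (\<lambda>x. F x i j) \<in> borel_measurable M"
  shows "(\<lambda>x. rdet n (F x)) \<in> borel_measurable M"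
proof -
  have "rdet n (F x) = (\<Sum>p\<in>{p. p permutes {0..<n}}. signof p * (\<Prod>i = 0..<n. F x i (p i)))" for x
  proof -
    have "rdet n (F x) = (\<Sum>p\<in>{p. p permutes {0..<n}}. signof p *
        (\<Prod>i = 0..<n. Matrix.mat n n (\<lambda>(i,j). F x i j) $$ (i, p i)))"
      unfolding rdet_def by (rule det_def') simp
    also have "\<dots> = (\<Sum>p\<in>{p. p permutes {0..<n}}. signof p * (\<Prod>i = 0..<n. F x i (p i)))"
    proof (rule sum.cong[OF refl])
      fix p assume "p \<in> {p. p permutes {0..<n}}"
      then have "p i < n" if "i < n" for i using permutes_in_image[of p "{0..<n}" i] that by auto
      then show "signof p * (\<Prod>i = 0..<n. Matrix.mat n n (\<lambda>(i,j). F x i j) $$ (i, p i))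
          = signof p * (\<Prod>i = 0..<n. F x i (p i))"
        by (auto intro!: prod.cong)
    qed
    finally show ?thesis .
  qed
  moreover have "(\<lambda>x. \<Sum>p\<in>{p. p permutes {0..<n}}. signof p * (\<Prod>i = 0..<n. F x i (p i)))
      \<in> borel_measurable M"
  proof (intro borel_measurable_sum borel_measurable_times borel_measurable_prod borel_measurable_const)
    fix p i assume "p \<in> {p. p permutes {0..<n}}" "i \<in> {0..<n}"
    then have "i < n" "p i < n" using permutes_in_image[of p "{0..<n}" i] by auto
    then show "(\<lambda>x. F x i (p i)) \<in> borel_measurable M" by (rule assms)
  qed
  ultimately show ?thesis by simp
qed

text \<open>Integrates the pointwise bound on the sum of the indicators. It serves twice: for the
  grid of rotations, where all probabilities are equal, and for the shifts that make the matrix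
  singular.\<close>

lemma (in prob_space) sum_prob_le_multiplicity:
  assumes J: "finite J" and B: "\<And>j. j \<in> J \<Longrightarrow> B j \<in> events"
    and r: "\<And>x. x \<in> space M \<Longrightarrow> card {j \<in> J. x \<in> B j} \<le> r"
  shows "(\<Sum>j\<in>J. prob (B j)) \<le> real r"
proof -
  have int: "integrable M (\<lambda>x. indicat_real (B j) x)" if "j \<in> J" for j
    using B[OF that] by (simp add: emeasure_eq_measure)
  have "(\<Sum>j\<in>J. prob (B j)) = (\<Sum>j\<in>J. \<integral>x. indicat_real (B j) x \<partial>M)"
    using B by (intro sum.cong) (simp_all add: sets.Int_space_eq2)
  also have "\<dots> = (\<integral>x. (\<Sum>j\<in>J. indicat_real (B j) x) \<partial>M)"
    using int by (rule Bochner_Integration.integral_sum[symmetric])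
  also have "\<dots> \<le> (\<integral>x. real r \<partial>M)"
  proof (rule integral_mono)
    fix x assume x: "x \<in> space M"
    have "(\<Sum>j\<in>J. indicat_real (B j) x) = real (card {j \<in> J. x \<in> B j})"
      using J by (simp add: indicator_def sum.If_cases Int_def)
    then show "(\<Sum>j\<in>J. indicat_real (B j) x) \<le> real r" using r[OF x] by simp
  qed (use int in auto)
  also have "\<dots> = real r" by (simp add: prob_space)
  finally show ?thesis .
qed

locale haar_orthogonal =
  fixes n :: nat and \<mu> :: "real Matrix.mat measure"
  assumes haar: "normalized_haar n \<mu>"
begin

sublocale prob_space \<mu>
  using haar by (simp add: normalized_haar_def)

lemma sets_haar: "sets \<mu> = sets (borel_orthogonal n)"
  using haar by (simp add: normalized_haar_def)

lemma space_haar: "space \<mu> = orthogonal_group n"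
  using sets_eq_imp_space_eq[OF sets_haar] by (simp add: borel_orthogonal_def)

lemma entry_measurable [measurable]:
  assumes "i < n" "j < n"
  shows "(\<lambda>U. U $$ (i,j)) \<in> borel_measurable \<mu>"
proof -
  have "(\<lambda>V. \<lambda>ij\<in>{..<n} \<times> {..<n}. V $$ ij)
      \<in> borel_orthogonal n \<rightarrow>\<^sub>M PiM ({..<n} \<times> {..<n}) (\<lambda>_. borel :: real measure)"
    unfolding borel_orthogonal_def by (rule measurable_vimage_algebra1) (auto simp: space_PiM)
  moreover have "(\<lambda>f. f (i,j)) \<in> PiM ({..<n} \<times> {..<n}) (\<lambda>_. borel) \<rightarrow>\<^sub>M (borel :: real measure)"
    using assms by (intro measurable_component_singleton) auto
  ultimately have "(\<lambda>f. f (i,j)) \<circ> (\<lambda>V. \<lambda>ij\<in>{..<n} \<times> {..<n}. V $$ ij)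
      \<in> borel_measurable (borel_orthogonal n)"
    by (rule measurable_comp)
  then have "(\<lambda>U. U $$ (i,j)) \<in> borel_measurable (borel_orthogonal n)"
    using assms by (simp add: comp_def)
  then show ?thesis using measurable_cong_sets[OF sets_haar refl] by blast
qed

lemma measurable_into_haar:
  assumes "\<And>x. x \<in> space M \<Longrightarrow> g x \<in> orthogonal_group n"
    and "\<And>i j. i < n \<Longrightarrow> j < n \<Longrightarrow> (\<lambda>x. g x $$ (i,j)) \<in> borel_measurable M"
  shows "g \<in> M \<rightarrow>\<^sub>M \<mu>"
proof -
  have "g \<in> M \<rightarrow>\<^sub>M borel_orthogonal n"
    unfolding borel_orthogonal_def
  proof (rule measurable_vimage_algebra2)
    show "(\<lambda>x. \<lambda>ij\<in>{..<n} \<times> {..<n}. g x $$ ij) \<in> M \<rightarrow>\<^sub>M PiM ({..<n} \<times> {..<n}) (\<lambda>_. borel)"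
      using assms(2) by (intro measurable_restrict) auto
  qed (use assms(1) in auto)
  then show ?thesis using measurable_cong_sets[OF refl sets_haar] by blast
qed

lemma mult_entry:
  assumes "V \<in> orthogonal_group n" "U \<in> orthogonal_group n" "i < n" "j < n"
  shows "(V * U) $$ (i,j) = (\<Sum>k<n. V $$ (i,k) * U $$ (k,j))"
  using assms by (auto simp: orthogonal_group_def scalar_prod_def atLeast0LessThan intro!: sum.cong)

lemma left_mult_measurable:
  assumes "V \<in> orthogonal_group n"
  shows "(\<lambda>U. V * U) \<in> \<mu> \<rightarrow>\<^sub>M \<mu>"
proof (rule measurable_into_haar)
  fix i j assume ij: "i < n" "j < n"
  have "(\<lambda>U. \<Sum>k<n. V $$ (i,k) * U $$ (k,j)) \<in> borel_measurable \<mu>"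
    using ij by (intro borel_measurable_sum borel_measurable_times borel_measurable_const entry_measurable) auto
  then show "(\<lambda>U. (V * U) $$ (i,j)) \<in> borel_measurable \<mu>"
    using ij assms by (subst measurable_cong[OF mult_entry]) (auto simp: space_haar)
qed (use assms orthogonal_group_mult in \<open>auto simp: space_haar\<close>)

lemma transpose_measurable: "transpose_mat \<in> \<mu> \<rightarrow>\<^sub>M \<mu>"
proof (rule measurable_into_haar)
  fix i j assume ij: "i < n" "j < n"
  have "(\<lambda>U. U $$ (j,i)) \<in> borel_measurable \<mu>" using ij by simp
  then show "(\<lambda>U. transpose_mat U $$ (i,j)) \<in> borel_measurable \<mu>"
    using ij by (subst measurable_cong[where g = "\<lambda>U. U $$ (j,i)"])
      (auto simp: space_haar orthogonal_group_def)
qed (use orthogonal_group_transpose in \<open>auto simp: space_haar\<close>)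

lemma emeasure_left_mult:
  assumes V: "V \<in> orthogonal_group n" and B: "B \<in> sets \<mu>"
  shows "emeasure \<mu> ((\<lambda>U. V * U) -` B \<inter> space \<mu>) = emeasure \<mu> B"
proof -
  have "distr \<mu> \<mu> (\<lambda>U. V * U) = \<mu>" using haar V by (simp add: normalized_haar_def)
  then show ?thesis
    using emeasure_distr[OF left_mult_measurable[OF V] B] by simp
qed

text \<open>Integrating \<open>B (x\<^sup>T y)\<close> over both variables, left invariance in \<open>y\<close> gives \<open>\<mu> B\<close>, while
  left invariance in \<open>x\<close> gives the measure of the transposed set.\<close>

lemma emeasure_transpose:
  assumes B: "B \<in> sets \<mu>"
  shows "emeasure \<mu> (transpose_mat -` B \<inter> space \<mu>) = emeasure \<mu> B"
proof -
  interpret P: pair_sigma_finite \<mu> \<mu> ..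
  define h where "h = (\<lambda>x y. transpose_mat x * y :: real Matrix.mat)"
  have h_meas: "case_prod h \<in> \<mu> \<Otimes>\<^sub>M \<mu> \<rightarrow>\<^sub>M \<mu>"
  proof (rule measurable_into_haar)
    fix i j assume ij: "i < n" "j < n"
    have "(\<lambda>z. \<Sum>k<n. fst z $$ (k,i) * snd z $$ (k,j)) \<in> borel_measurable (\<mu> \<Otimes>\<^sub>M \<mu>)"
      using ij
      by (intro borel_measurable_sum borel_measurable_times
          measurable_compose[OF measurable_fst] measurable_compose[OF measurable_snd]
          entry_measurable) auto
    then show "(\<lambda>z. case_prod h z $$ (i,j)) \<in> borel_measurable (\<mu> \<Otimes>\<^sub>M \<mu>)"
    proof (rule measurable_cong[THEN iffD1, rotated])
      fix z assume "z \<in> space (\<mu> \<Otimes>\<^sub>M \<mu>)"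
      then obtain x y where z: "z = (x,y)" "x \<in> orthogonal_group n" "y \<in> orthogonal_group n"
        by (auto simp: space_pair_measure space_haar)
      then show "(\<Sum>k<n. fst z $$ (k,i) * snd z $$ (k,j)) = case_prod h z $$ (i,j)"
        using ij mult_entry[OF orthogonal_group_transpose[OF z(2)] z(3), of i j]
        by (auto simp: h_def orthogonal_group_def intro!: sum.cong)
    qed
  qed (auto simp: h_def space_pair_measure space_haar orthogonal_group_mult orthogonal_group_transpose)
  have ind: "(\<lambda>z. indicator B (case_prod h z) :: ennreal) \<in> borel_measurable (\<mu> \<Otimes>\<^sub>M \<mu>)"
    using B h_meas by simp
  have tB: "transpose_mat -` B \<inter> space \<mu> \<in> sets \<mu>"
    using transpose_measurable B by (rule measurable_sets)
  have inner: "(\<integral>\<^sup>+y. indicator A (h x y) \<partial>\<mu>) = emeasure \<mu> A"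
    if "x \<in> space \<mu>" "A \<in> sets \<mu>" for x A
  proof -
    have x: "transpose_mat x \<in> orthogonal_group n"
      using that orthogonal_group_transpose by (simp add: space_haar)
    have "(\<integral>\<^sup>+y. indicator A (h x y) \<partial>\<mu>) = (\<integral>\<^sup>+y. indicator (h x -` A \<inter> space \<mu>) y \<partial>\<mu>)"
      by (intro nn_integral_cong) (auto simp: indicator_def)
    also have "\<dots> = emeasure \<mu> (h x -` A \<inter> space \<mu>)"
      using measurable_sets[OF left_mult_measurable[OF x] that(2)] by (simp add: h_def)
    also have "\<dots> = emeasure \<mu> A" using emeasure_left_mult[OF x that(2)] by (simp add: h_def)
    finally show ?thesis .
  qed
  have "emeasure \<mu> B = (\<integral>\<^sup>+x. emeasure \<mu> B \<partial>\<mu>)" by (simp add: emeasure_space_1)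
  also have "\<dots> = (\<integral>\<^sup>+x. (\<integral>\<^sup>+y. indicator B (h x y) \<partial>\<mu>) \<partial>\<mu>)"
    using B by (intro nn_integral_cong) (simp add: inner)
  also have "\<dots> = (\<integral>\<^sup>+y. (\<integral>\<^sup>+x. indicator B (h x y) \<partial>\<mu>) \<partial>\<mu>)"
    using ind by (intro P.Fubini'[symmetric]) (simp add: case_prod_beta')
  also have "\<dots> = (\<integral>\<^sup>+y. (\<integral>\<^sup>+x. indicator (transpose_mat -` B \<inter> space \<mu>) (h y x) \<partial>\<mu>) \<partial>\<mu>)"
  proof (intro nn_integral_cong)
    fix x y assume xy: "x \<in> space \<mu>" "y \<in> space \<mu>"
    then have c: "x \<in> carrier_mat n n" "y \<in> carrier_mat n n"
      by (auto simp: space_haar orthogonal_group_def)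
    have "h y x \<in> space \<mu>"
      using xy by (auto simp: h_def space_haar orthogonal_group_mult orthogonal_group_transpose)
    moreover have "transpose_mat (h y x) = h x y"
      using c by (simp add: h_def transpose_mult[of _ n n _ n])
    ultimately show "indicator B (h x y) = (indicator (transpose_mat -` B \<inter> space \<mu>) (h y x) :: ennreal)"
      by (simp add: indicator_def)
  qed
  also have "\<dots> = (\<integral>\<^sup>+y. emeasure \<mu> (transpose_mat -` B \<inter> space \<mu>) \<partial>\<mu>)"
    using tB by (intro nn_integral_cong) (simp add: inner)
  finally show ?thesis by (simp add: emeasure_space_1)
qed

lemma prob_left_mult:
  assumes "V \<in> orthogonal_group n" "{U \<in> space \<mu>. P U} \<in> events"
  shows "prob {U \<in> space \<mu>. P (V * U)} = prob {U \<in> space \<mu>. P U}"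
    and "{U \<in> space \<mu>. P (V * U)} \<in> events"
proof -
  have eq: "{U \<in> space \<mu>. P (V * U)} = (\<lambda>U. V * U) -` {U \<in> space \<mu>. P U} \<inter> space \<mu>"
    using assms orthogonal_group_mult by (auto simp: space_haar)
  show "prob {U \<in> space \<mu>. P (V * U)} = prob {U \<in> space \<mu>. P U}"
    unfolding eq measure_def emeasure_left_mult[OF assms] ..
  show "{U \<in> space \<mu>. P (V * U)} \<in> events"
    unfolding eq using left_mult_measurable[OF assms(1)] assms(2) by (rule measurable_sets)
qed

lemma prob_transpose:
  assumes "{U \<in> space \<mu>. P U} \<in> events"
  shows "prob {U \<in> space \<mu>. P (transpose_mat U)} = prob {U \<in> space \<mu>. P U}"
    and "{U \<in> space \<mu>. P (transpose_mat U)} \<in> events"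
proof -
  have eq: "{U \<in> space \<mu>. P (transpose_mat U)} = transpose_mat -` {U \<in> space \<mu>. P U} \<inter> space \<mu>"
    using orthogonal_group_transpose by (auto simp: space_haar)
  show "prob {U \<in> space \<mu>. P (transpose_mat U)} = prob {U \<in> space \<mu>. P U}"
    unfolding eq measure_def emeasure_transpose[OF assms] ..
  show "{U \<in> space \<mu>. P (transpose_mat U)} \<in> events"
    unfolding eq using transpose_measurable assms by (rule measurable_sets)
qed

text \<open>Right multiplication by \<open>W\<close> is left multiplication by its transpose between
  two transpositions, so left invariance and invariance under transposition give both sides.\<close>

lemma prob_two_sided_mult:
  assumes V: "V \<in> orthogonal_group n" "W \<in> orthogonal_group n" and P: "{U \<in> space \<mu>. P U} \<in> events"
  shows "prob {U \<in> space \<mu>. P (V * U * W)} = prob {U \<in> space \<mu>. P U}"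
    and "{U \<in> space \<mu>. P (V * U * W)} \<in> events"
proof -
  note 1 = prob_left_mult[OF V(1) P]
  note 2 = prob_transpose[OF 1(2)]
  note 3 = prob_left_mult[OF orthogonal_group_transpose[OF V(2)] 2(2)]
  note 4 = prob_transpose[OF 3(2)]
  have "V * transpose_mat (transpose_mat W * transpose_mat U) = V * U * W" if "U \<in> space \<mu>" for U
  proof -
    have "U \<in> carrier_mat n n" "V \<in> carrier_mat n n" "W \<in> carrier_mat n n"
      using that V by (auto simp: space_haar orthogonal_group_def)
    then show ?thesis by (simp add: transpose_mult[of _ n n _ n] assoc_mult_mat[of _ n n])
  qed
  then have eq: "{U \<in> space \<mu>. P (V * U * W)}
      = {U \<in> space \<mu>. P (V * transpose_mat (transpose_mat W * transpose_mat U))}"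
    by auto
  show "prob {U \<in> space \<mu>. P (V * U * W)} = prob {U \<in> space \<mu>. P U}"
    unfolding eq using 1 2 3 4 by simp
  show "{U \<in> space \<mu>. P (V * U * W)} \<in> events"
    unfolding eq using 4 by simp
qed

section \<open>Comparison of determinants under random rotations\<close>

abbreviation sum_det_mat :: "(nat \<Rightarrow> nat \<Rightarrow> real) \<Rightarrow> real Matrix.mat \<Rightarrow> real" where
  "sum_det_mat X U \<equiv> sum_det n X (\<lambda>i j. U $$ (i,j))"

lemma sum_det_mat_measurable [measurable]: "sum_det_mat X \<in> borel_measurable \<mu>"
  unfolding sum_det_def by (intro borel_measurable_rdet borel_measurable_add) auto

text \<open>By left invariance the probability equals its average over the N rotations
  \<open>V j\<close> of the grid, and for fixed \<open>U\<close> at most two of these are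
  bad.\<close>

lemma prob_rotate_rows_step:
  assumes N: "N > 0" and pq: "p < n" "q < n" "p \<noteq> q" and ab: "a\<^sup>2 + b\<^sup>2 = 1"
  shows "prob {U \<in> space \<mu>. 200 * (real N)\<^sup>2 * \<bar>sum_det_mat X U\<bar> < \<bar>sum_det_mat (rotate_rows p q a b X) U\<bar>} \<le> 2 / N"
proof -
  define P where "P = (\<lambda>U. 200 * (real N)\<^sup>2 * \<bar>sum_det_mat X U\<bar> < \<bar>sum_det_mat (rotate_rows p q a b X) U\<bar>)"
  have meas: "{U \<in> space \<mu>. P U} \<in> events" unfolding P_def by measurable
  \<comment> \<open>The sine is negated because \<open>sum_det_rotate_rows_rotate\<close> inverts
    the rotation when it passes to \<open>X\<close>.\<close>
  define V where "V = (\<lambda>j. rotation_mat n p q (grid_cos N j) (- grid_sin N j))"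
  have V: "V j \<in> orthogonal_group n" for j
    unfolding V_def using grid_cos_sin by (intro rotation_mat_orthogonal pq) auto
  have card: "card {j \<in> {..<N}. U \<in> {U \<in> space \<mu>. P (V j * U)}} \<le> 2" if U: "U \<in> space \<mu>" for U
  proof -
    have rot: "sum_det_mat Y (V j * U) = sum_det_mat (rotate_rows p q (grid_cos N j) (grid_sin N j) Y) U" for Y j
    proof -
      have c: "U \<in> carrier_mat n n" using U by (simp add: space_haar orthogonal_group_def)
      have "sum_det_mat Y (V j * U) = sum_det n Y (rotate_rows p q (grid_cos N j) (- grid_sin N j) (\<lambda>i j. U $$ (i,j)))"
        unfolding sum_det_def V_def
        by (rule rdet_cong) (simp add: rotation_mat_mult_index[OF pq c])
      then show ?thesis using sum_det_rotate_rows_rotate[OF pq, of "grid_cos N j" "- grid_sin N j"] grid_cos_sin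
        by simp
    qed
    obtain \<alpha> \<beta> \<gamma> where f: "\<And>a b. a\<^sup>2 + b\<^sup>2 = 1 \<Longrightarrow> sum_det_mat (rotate_rows p q a b X) U = \<alpha> + \<beta> * a + \<gamma> * b"
      using sum_det_rotate_rows_affine[OF pq] by blast
    have le1: "\<bar>a\<bar> \<le> 1 \<and> \<bar>b\<bar> \<le> 1" if "a\<^sup>2 + b\<^sup>2 = 1" for a b :: real
    proof -
      have "a\<^sup>2 \<le> 1" "b\<^sup>2 \<le> 1" using that zero_le_power2[of a] zero_le_power2[of b] by linarith+
      then show ?thesis by (simp add: abs_square_le_1)
    qed
    \<comment> \<open>The determinant to be compared with is the same affine function, taken at the
      grid angle advanced by the angle of \<open>a\<close>, \<open>b\<close>.\<close>
    have bd: "\<bar>sum_det_mat (rotate_rows p q a b (rotate_rows p q (grid_cos N j) (grid_sin N j) X)) U\<bar> \<le> \<bar>\<alpha>\<bar> + \<bar>\<beta>\<bar> + \<bar>\<gamma>\<bar>" for j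
    proof -
      let ?a = "a * grid_cos N j - b * grid_sin N j" and ?b = "a * grid_sin N j + b * grid_cos N j"
      have "?a\<^sup>2 + ?b\<^sup>2 = (a\<^sup>2 + b\<^sup>2) * ((grid_cos N j)\<^sup>2 + (grid_sin N j)\<^sup>2)"
        by (simp add: power2_eq_square algebra_simps)
      then have 1: "?a\<^sup>2 + ?b\<^sup>2 = 1" using ab grid_cos_sin by simp
      have "\<bar>\<alpha> + \<beta> * ?a + \<gamma> * ?b\<bar> \<le> \<bar>\<alpha>\<bar> + \<bar>\<beta> * ?a\<bar> + \<bar>\<gamma> * ?b\<bar>" by linarith
      also have "\<dots> \<le> \<bar>\<alpha>\<bar> + \<bar>\<beta>\<bar> + \<bar>\<gamma>\<bar>"
        using le1[OF 1] unfolding abs_mult by (intro add_mono order.refl mult_left_le) auto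
      finally show ?thesis unfolding rotate_rows_rotate_rows[OF pq(3)] f[OF 1] .
    qed
    have "card {j \<in> {..<N}. U \<in> {U \<in> space \<mu>. P (V j * U)}}
        = card {j. j < N \<and> 200 * (real N)\<^sup>2 * \<bar>\<alpha> + \<beta> * grid_cos N j + \<gamma> * grid_sin N j\<bar>
          < \<bar>sum_det_mat (rotate_rows p q a b (rotate_rows p q (grid_cos N j) (grid_sin N j) X)) U\<bar>}"
    proof (intro arg_cong[of _ _ card] Collect_cong)
      fix j
      have comm: "rotate_rows p q (grid_cos N j) (grid_sin N j) (rotate_rows p q a b X)
          = rotate_rows p q a b (rotate_rows p q (grid_cos N j) (grid_sin N j) X)"
        unfolding rotate_rows_rotate_rows[OF pq(3)] by (simp add: mult.commute add.commute)
      show "(j \<in> {..<N} \<and> U \<in> {U \<in> space \<mu>. P (V j * U)}) \<longleftrightarrow>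
        (j < N \<and> 200 * (real N)\<^sup>2 * \<bar>\<alpha> + \<beta> * grid_cos N j + \<gamma> * grid_sin N j\<bar>
          < \<bar>sum_det_mat (rotate_rows p q a b (rotate_rows p q (grid_cos N j) (grid_sin N j) X)) U\<bar>)"
        using U by (simp add: P_def rot comm f[OF grid_cos_sin])
    qed
    also have "\<dots> \<le> 2" using N bd by (rule grid_bad_card)
    finally show ?thesis .
  qed
  have "real N * prob {U \<in> space \<mu>. P U} = (\<Sum>j<N. prob {U \<in> space \<mu>. P (V j * U)})"
    using prob_left_mult(1)[OF V meas] by simp
  also have "\<dots> \<le> real 2"
    using card prob_left_mult(2)[OF V meas] by (intro sum_prob_le_multiplicity) auto
  finally show ?thesis using N unfolding P_def by (simp add: field_simps)
qed

lemma sum_det_mat_transpose: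
  assumes "U \<in> space \<mu>"
  shows "sum_det_mat X (transpose_mat U) = sum_det_mat (\<lambda>i j. X j i) U"
proof -
  have "sum_det_mat X (transpose_mat U) = rdet n (\<lambda>i j. X i j + U $$ (j,i))"
    unfolding sum_det_def
    by (rule rdet_cong) (use assms in \<open>auto simp: space_haar orthogonal_group_def\<close>)
  also have "\<dots> = sum_det_mat (\<lambda>i j. X j i) U"
    unfolding sum_det_def by (subst rdet_transpose[symmetric]) simp
  finally show ?thesis .
qed

lemma prob_move_step:
  assumes N: "N > 0" and F: "F \<in> moves n"
  shows "prob {U \<in> space \<mu>. 200 * (real N)\<^sup>2 * \<bar>sum_det_mat X U\<bar> < \<bar>sum_det_mat (F X) U\<bar>} \<le> 2 / N"
proof -
  from F obtain p q where pq: "p < n" "q < n" "p \<noteq> q"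
    and "F = rotate_rows p q 0 1 \<or> F = rotate_rows p q (- 1) 0 \<or> F = rotate_cols p q 0 1"
    unfolding moves_def by auto
  then consider "F = rotate_rows p q 0 1" | "F = rotate_rows p q (- 1) 0" | "F = rotate_cols p q 0 1" by blast
  then show ?thesis
  proof cases
    \<comment> \<open>A column turn of \<open>X\<close> is a row turn of its transpose, and the law
      of \<open>U\<close> is invariant under transposition.\<close>
    case 3
    define X' where "X' = (\<lambda>i j. X j i)"
    define P where "P = (\<lambda>U. 200 * (real N)\<^sup>2 * \<bar>sum_det_mat X' U\<bar> < \<bar>sum_det_mat (rotate_rows p q 0 1 X') U\<bar>)"
    have meas: "{U \<in> space \<mu>. P U} \<in> events" unfolding P_def by measurable
    have "{U \<in> space \<mu>. 200 * (real N)\<^sup>2 * \<bar>sum_det_mat X U\<bar> < \<bar>sum_det_mat (F X) U\<bar>}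
        = {U \<in> space \<mu>. P (transpose_mat U)}"
      by (intro Collect_cong conj_cong refl) (simp add: P_def sum_det_mat_transpose 3 rotate_cols_def X'_def)
    then show ?thesis
      using prob_transpose(1)[OF meas] prob_rotate_rows_step[OF N pq, of 0 1 X'] by (simp add: P_def)
  qed (use prob_rotate_rows_step[OF N pq] in auto)
qed

text \<open>A union bound along the chain of moves: if no step loses more than the factor 200 N^2,
  the whole chain loses at most its power. Steps without a move are harmless because this factor is
  at least 1.\<close>

lemma prob_reachable_step:
  assumes N: "N > 0" and Y: "Y \<in> reachable n m X"
  shows "prob {U \<in> space \<mu>. (200 * (real N)\<^sup>2) ^ m * \<bar>sum_det_mat X U\<bar> < \<bar>sum_det_mat Y U\<bar>} \<le> 2 * m / N"
  using Y
proof (induction m arbitrary: Y)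
  case 0
  then show ?case by simp
next
  case (Suc m)
  define L where "L = 200 * (real N)\<^sup>2"
  have "1 \<le> (real N)\<^sup>2" using N by (intro one_le_power) simp
  then have L: "L \<ge> 1" by (simp add: L_def)
  have *: "\<And>Z m. {U \<in> space \<mu>. L ^ m * \<bar>sum_det_mat X U\<bar> < \<bar>sum_det_mat Z U\<bar>} \<in> events"
    "\<And>Z W. {U \<in> space \<mu>. L * \<bar>sum_det_mat Z U\<bar> < \<bar>sum_det_mat W U\<bar>} \<in> events"
    by measurable
  from Suc.prems consider "Y \<in> reachable n m X" | F Z where "F \<in> moves n" "Z \<in> reachable n m X" "Y = F Z"
    by auto
  then have "prob {U \<in> space \<mu>. L ^ Suc m * \<bar>sum_det_mat X U\<bar> < \<bar>sum_det_mat Y U\<bar>} \<le> 2 * m / N + 2 / N"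
  proof cases
    case 1
    have "prob {U \<in> space \<mu>. L ^ Suc m * \<bar>sum_det_mat X U\<bar> < \<bar>sum_det_mat Y U\<bar>}
        \<le> prob {U \<in> space \<mu>. L ^ m * \<bar>sum_det_mat X U\<bar> < \<bar>sum_det_mat Y U\<bar>}"
    proof (intro finite_measure_mono *)
      have "L ^ m * \<bar>sum_det_mat X U\<bar> \<le> L ^ Suc m * \<bar>sum_det_mat X U\<bar>" for U
        using L by (intro mult_right_mono power_increasing) auto
      then show "{U \<in> space \<mu>. L ^ Suc m * \<bar>sum_det_mat X U\<bar> < \<bar>sum_det_mat Y U\<bar>}
        \<subseteq> {U \<in> space \<mu>. L ^ m * \<bar>sum_det_mat X U\<bar> < \<bar>sum_det_mat Y U\<bar>}"
        by (auto intro: order.strict_trans1)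
    qed
    moreover have "prob {U \<in> space \<mu>. L ^ m * \<bar>sum_det_mat X U\<bar> < \<bar>sum_det_mat Y U\<bar>} \<le> 2 * m / N"
      using Suc.IH[OF 1] by (simp add: L_def)
    moreover have "0 \<le> 2 / real N" by simp
    ultimately show ?thesis by linarith
  next
    case 2
    have "prob {U \<in> space \<mu>. L ^ Suc m * \<bar>sum_det_mat X U\<bar> < \<bar>sum_det_mat Y U\<bar>}
        \<le> prob ({U \<in> space \<mu>. L ^ m * \<bar>sum_det_mat X U\<bar> < \<bar>sum_det_mat Z U\<bar>} \<union> {U \<in> space \<mu>. L * \<bar>sum_det_mat Z U\<bar> < \<bar>sum_det_mat Y U\<bar>})"
    proof (intro finite_measure_mono sets.Un *)
      show "{U \<in> space \<mu>. L ^ Suc m * \<bar>sum_det_mat X U\<bar> < \<bar>sum_det_mat Y U\<bar>}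
        \<subseteq> {U \<in> space \<mu>. L ^ m * \<bar>sum_det_mat X U\<bar> < \<bar>sum_det_mat Z U\<bar>} \<union> {U \<in> space \<mu>. L * \<bar>sum_det_mat Z U\<bar> < \<bar>sum_det_mat Y U\<bar>}"
      proof safe
        fix U assume a: "L ^ Suc m * \<bar>sum_det_mat X U\<bar> < \<bar>sum_det_mat Y U\<bar>" "\<not> L * \<bar>sum_det_mat Z U\<bar> < \<bar>sum_det_mat Y U\<bar>"
        then have "L * (L ^ m * \<bar>sum_det_mat X U\<bar>) < L * \<bar>sum_det_mat Z U\<bar>"
          unfolding power_Suc mult.assoc by linarith
        then show "L ^ m * \<bar>sum_det_mat X U\<bar> < \<bar>sum_det_mat Z U\<bar>"
          by (rule mult_left_less_imp_less) (use L in linarith)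
      qed
    qed
    also have "\<dots> \<le> prob {U \<in> space \<mu>. L ^ m * \<bar>sum_det_mat X U\<bar> < \<bar>sum_det_mat Z U\<bar>}
        + prob {U \<in> space \<mu>. L * \<bar>sum_det_mat Z U\<bar> < \<bar>sum_det_mat Y U\<bar>}"
      by (intro measure_Un_le *)
    also have "\<dots> \<le> 2 * m / N + 2 / N"
      using Suc.IH[OF 2(2)] prob_move_step[OF N 2(1), of Z] 2(3) unfolding L_def
      by (intro add_mono) auto
    finally show ?thesis .
  qed
  then show ?case unfolding L_def by (simp add: add_divide_distrib algebra_simps)
qed

end

subsection \<open>Singular value decomposition\<close>

text \<open>An eigenvalue \<open>z\<close> exists over the complex numbers. The form
  \<open>q\<close> is real by symmetry and equals \<open>z\<close> times the squared norm of the
  eigenvector, so \<open>z\<close> is real and a root of the characteristic polynomial of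
  \<open>A\<close> itself.\<close>

lemma symmetric_real_eigenvalue:
  fixes A :: "real Matrix.mat"
  assumes A: "A \<in> carrier_mat n n" and sym: "transpose_mat A = A" and n: "n > 0"
  obtains l where "eigenvalue A l"
proof -
  define C where "C = map_mat complex_of_real A"
  have C: "C \<in> carrier_mat n n" using A by (simp add: C_def)
  obtain z where z: "eigenvalue C z"
    using spectrum_non_empty[OF C n] by (auto simp: spectrum_def)
  then obtain v where v: "v \<in> carrier_vec n" "v \<noteq> 0\<^sub>v n" "C *\<^sub>v v = z \<cdot>\<^sub>v v"
    using C by (auto simp: eigenvalue_def eigenvector_def)
  define q where "q = (\<Sum>i<n. \<Sum>j<n. cnj (vec_index v i) * complex_of_real (A $$ (i,j)) * vec_index v j)"
  have Av: "(\<Sum>j<n. complex_of_real (A $$ (i,j)) * vec_index v j) = z * vec_index v i" if "i < n" for i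
  proof -
    have "vec_index (C *\<^sub>v v) i = (\<Sum>j<n. complex_of_real (A $$ (i,j)) * vec_index v j)"
      using that v(1) A by (auto simp: C_def scalar_prod_def atLeast0LessThan intro!: sum.cong)
    then show ?thesis using v that by simp
  qed
  have q1: "q = z * complex_of_real (\<Sum>i<n. (cmod (vec_index v i))\<^sup>2)"
  proof -
    have "q = (\<Sum>i<n. cnj (vec_index v i) * (z * vec_index v i))"
      unfolding q_def by (intro sum.cong refl) (simp add: Av[symmetric] sum_distrib_left mult.assoc)
    also have "\<dots> = (\<Sum>i<n. z * complex_of_real ((cmod (vec_index v i))\<^sup>2))"
      by (intro sum.cong refl) (simp add: complex_norm_square[unfolded of_real_power] mult_ac)
    finally show ?thesis by (simp add: sum_distrib_left)
  qed
  have "cnj q = (\<Sum>i<n. \<Sum>j<n. vec_index v i * complex_of_real (A $$ (i,j)) * cnj (vec_index v j))"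
    by (simp add: q_def)
  also have "\<dots> = (\<Sum>j<n. \<Sum>i<n. vec_index v i * complex_of_real (A $$ (i,j)) * cnj (vec_index v j))"
    by (rule sum.swap)
  also have "\<dots> = q"
    unfolding q_def
  proof (intro sum.cong refl)
    fix i j assume "i \<in> {..<n}" "j \<in> {..<n}"
    then have "A $$ (j,i) = A $$ (i,j)" using sym A by (metis carrier_matD index_transpose_mat(1) lessThan_iff)
    then show "vec_index v j * complex_of_real (A $$ (j,i)) * cnj (vec_index v i)
        = cnj (vec_index v i) * complex_of_real (A $$ (i,j)) * vec_index v j" by simp
  qed
  finally have q2: "cnj q = q" .
  define s where "s = (\<Sum>i<n. (cmod (vec_index v i))\<^sup>2)"
  have s: "s \<noteq> 0"
  proof
    assume "s = 0"
    then have "\<forall>i<n. vec_index v i = 0" by (simp add: s_def sum_nonneg_eq_0_iff)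
    then have "v = 0\<^sub>v n" using v(1) by (intro eq_vecI) auto
    then show False using v(2) by simp
  qed
  have "cnj z * complex_of_real s = z * complex_of_real s"
    using q1 q2 by (simp add: s_def)
  then have "cnj z = z" using s by simp
  then obtain l where l: "z = complex_of_real l"
    by (metis Reals_cnj_iff Reals_cases)
  have "poly (char_poly C) z = 0" using z eigenvalue_root_char_poly[OF C] by simp
  then have "complex_of_real (poly (char_poly A) l) = 0"
    unfolding l C_def of_real_hom.char_poly_hom[OF A] by simp
  then have "eigenvalue A l" using eigenvalue_root_char_poly[OF A] by simp
  then show ?thesis by (rule that)
qed

lemma scalar_prod_mult_mat_vec:
  fixes A :: "real Matrix.mat"
  assumes "A \<in> carrier_mat n n" "x \<in> carrier_vec n" "y \<in> carrier_vec n"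
  shows "scalar_prod (A *\<^sub>v x) (A *\<^sub>v y) = scalar_prod x ((transpose_mat A * A) *\<^sub>v y)"
proof -
  have "scalar_prod (A *\<^sub>v y) (A *\<^sub>v x) = scalar_prod (transpose_mat A *\<^sub>v (A *\<^sub>v y)) x"
    using assms by (intro transpose_vec_mult_scalar[symmetric]) auto
  then show ?thesis
    using assms by (simp add: comm_scalar_prod[of _ n] assoc_mult_mat_vec[of _ n n _ n])
qed

lemma scalar_prod_orthogonal:
  assumes "V \<in> orthogonal_group n" "x \<in> carrier_vec n"
  shows "scalar_prod (V *\<^sub>v x) (V *\<^sub>v x) = scalar_prod x x"
  using assms scalar_prod_mult_mat_vec[of V n x x] by (simp add: orthogonal_group_def)

lemma scalar_prod_self_eq_0:
  fixes x :: "real Matrix.vec"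
  assumes "x \<in> carrier_vec n" "scalar_prod x x = 0"
  shows "x = 0\<^sub>v n"
proof (rule eq_vecI)
  fix i assume "i < dim_vec (0\<^sub>v n :: real Matrix.vec)"
  moreover have "\<forall>i\<in>{0..<n}. vec_index x i * vec_index x i = 0"
    using assms by (subst sum_nonneg_eq_0_iff[symmetric]) (auto simp: scalar_prod_def)
  ultimately show "vec_index x i = vec_index (0\<^sub>v n) i" by simp
qed (use assms in simp)

lemma scalar_prod_self_nonneg: "scalar_prod x x \<ge> (0::real)"
  by (auto simp: scalar_prod_def intro: sum_nonneg)

lemma normalize_vec:
  fixes x :: "real Matrix.vec"
  assumes "x \<in> carrier_vec n" "x \<noteq> 0\<^sub>v n"
  obtains c where "scalar_prod (c \<cdot>\<^sub>v x) (c \<cdot>\<^sub>v x) = 1"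
proof
  have "scalar_prod x x > 0"
    using scalar_prod_self_nonneg[of x] scalar_prod_self_eq_0[OF assms(1)] assms(2) by force
  then show "scalar_prod (1 / sqrt (scalar_prod x x) \<cdot>\<^sub>v x) (1 / sqrt (scalar_prod x x) \<cdot>\<^sub>v x) = 1"
    by (simp add: divide_simps)
qed

lemma unit_eigenvector:
  fixes A :: "real Matrix.mat"
  assumes A: "A \<in> carrier_mat n n" and l: "eigenvalue (transpose_mat A * A) l"
  obtains v where "v \<in> carrier_vec n" "scalar_prod v v = 1"
    "(transpose_mat A * A) *\<^sub>v v = l \<cdot>\<^sub>v v" "scalar_prod (A *\<^sub>v v) (A *\<^sub>v v) = l"
proof -
  obtain w where w: "w \<in> carrier_vec n" "w \<noteq> 0\<^sub>v n" "(transpose_mat A * A) *\<^sub>v w = l \<cdot>\<^sub>v w"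
    using l A by (auto simp: eigenvalue_def eigenvector_def)
  obtain c where c: "scalar_prod (c \<cdot>\<^sub>v w) (c \<cdot>\<^sub>v w) = 1"
    using normalize_vec[OF w(1,2)] .
  define v where "v = c \<cdot>\<^sub>v w"
  have v: "v \<in> carrier_vec n" "scalar_prod v v = 1" using w c by (auto simp: v_def)
  have ev: "(transpose_mat A * A) *\<^sub>v v = l \<cdot>\<^sub>v v"
    using mult_mat_vec[of "transpose_mat A * A" n n w c] A w by (simp add: v_def smult_smult_assoc mult.commute)
  have "scalar_prod (A *\<^sub>v v) (A *\<^sub>v v) = l"
    unfolding scalar_prod_mult_mat_vec[OF A v(1) v(1)] ev using v by simp
  then show ?thesis using that v ev by blast
qed

text \<open>The minimum in \<open>s_min\<close> is attained: the set is finite as an image of roots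
  of a polynomial, and nonempty by \<open>symmetric_real_eigenvalue\<close>. A unit eigenvector is
  the witness.\<close>

lemma s_min_le_witness:
  fixes A :: "real Matrix.mat"
  assumes A: "A \<in> carrier_mat n n" and n: "n > 0" and s: "s_min A \<le> t"
  obtains x where "x \<in> carrier_vec n" "scalar_prod x x = 1"
    "sqrt (scalar_prod (A *\<^sub>v x) (A *\<^sub>v x)) \<le> t"
proof -
  let ?B = "transpose_mat A * A"
  have B: "?B \<in> carrier_mat n n" using A by simp
  obtain l0 where "eigenvalue ?B l0"
    by (rule symmetric_real_eigenvalue[OF B _ n]) (use A in \<open>simp add: transpose_mult[of _ n n]\<close>)
  then have ne: "singular_values A \<noteq> {}" by (auto simp: singular_values_def)
  have "finite {l. eigenvalue ?B l}"
    using degree_monic_char_poly[OF B] n eigenvalue_root_char_poly[OF B]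
    by (auto intro!: poly_roots_finite)
  then have "finite (singular_values A)"
    unfolding singular_values_def by (simp add: setcompr_eq_image)
  then have "s_min A \<in> singular_values A" unfolding s_min_def using ne by simp
  then obtain l where l: "s_min A = sqrt l" "eigenvalue ?B l" by (auto simp: singular_values_def)
  show ?thesis using unit_eigenvector[OF A l(2)] that l(1) s by metis
qed

text \<open>The reflection along w = v - e_0, with matrix 1 - (2/|w|^2) w w^T. It degenerates for v
  = e_0, where the identity is taken.\<close>

lemma householder:
  fixes v :: "real Matrix.vec"
  assumes v: "v \<in> carrier_vec n" "scalar_prod v v = 1" and n: "n > 0"
  obtains H where "H \<in> carrier_mat n n" "transpose_mat H = H" "H * H = 1\<^sub>m n" "H *\<^sub>v unit_vec n 0 = v"
proof (cases "v = unit_vec n 0")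
  case True
  then show ?thesis using that[of "1\<^sub>m n"] by simp
next
  case False
  define w where "w = (\<lambda>i. vec_index v i - (if i = 0 then 1 else 0))"
  define S where "S = (\<Sum>k<n. w k * w k)"
  have vv: "(\<Sum>i<n. vec_index v i * vec_index v i) = 1"
    using v by (simp add: scalar_prod_def atLeast0LessThan)
  have "S = (\<Sum>i<n. vec_index v i * vec_index v i - (if i = 0 then 2 * vec_index v i - 1 else 0))"
    unfolding S_def w_def by (intro sum.cong refl) (auto simp: algebra_simps)
  also have "\<dots> = 2 - 2 * vec_index v 0"
    using vv n by (simp add: sum_subtractf)
  finally have S: "S = 2 - 2 * vec_index v 0" .
  have "S \<noteq> 0"
  proof
    assume "S = 0"
    then have "\<forall>i<n. w i = 0" unfolding S_def by (subst (asm) sum_nonneg_eq_0_iff) auto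
    then have "v = unit_vec n 0" using v n by (intro eq_vecI) (auto simp: w_def)
    then show False using False by simp
  qed
  define c where "c = 2 / S"
  have cS: "c * S = 2" using \<open>S \<noteq> 0\<close> by (simp add: c_def)
  define H where "H = Matrix.mat n n (\<lambda>(i,j). (if i = j then 1 else 0) - c * (w i * w j))"
  have H: "H \<in> carrier_mat n n" by (simp add: H_def)
  have sym: "transpose_mat H = H" unfolding H_def by (intro eq_matI) auto
  have "H * H = 1\<^sub>m n"
  proof (rule eq_matI)
    fix i j assume "i < dim_row (1\<^sub>m n :: real Matrix.mat)" "j < dim_col (1\<^sub>m n :: real Matrix.mat)"
    then have ij: "i < n" "j < n" by auto
    have "(H * H) $$ (i,j) = (\<Sum>k<n. ((if i = k then 1 else 0) - c * (w i * w k))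
        * ((if k = j then 1 else 0) - c * (w k * w j)))"
      using ij by (simp add: H_def scalar_prod_def atLeast0LessThan)
    also have "\<dots> = (\<Sum>k<n. (if i = k then (if k = j then 1 else 0) - c * (w k * w j) else 0)
        - (if k = j then c * (w i * w k) else 0) + (c * c * w i * w j) * (w k * w k))"
      by (intro sum.cong refl) (auto simp: algebra_simps)
    also have "\<dots> = ((if i = j then 1 else 0) - c * (w i * w j)) - c * (w i * w j)
        + (c * c * w i * w j) * S"
      using ij by (simp add: sum.distrib sum_subtractf S_def sum_distrib_left)
    also have "(c * c * w i * w j) * S = 2 * c * (w i * w j)"
      using cS by (simp add: mult_ac)
    finally show "(H * H) $$ (i,j) = 1\<^sub>m n $$ (i,j)" using ij by simp
  qed (simp_all add: H_def)
  moreover have "H *\<^sub>v unit_vec n 0 = v"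
  proof (rule eq_vecI)
    fix i assume "i < dim_vec v"
    then have i: "i < n" using v by simp
    have cw: "c * w 0 = - 1" using cS S n by (simp add: w_def algebra_simps)
    have "vec_index (H *\<^sub>v unit_vec n 0) i = H $$ (i,0)"
      using i n H by (simp add: mult_mat_vec_def)
    also have "\<dots> = (if i = 0 then 1 else 0) - w i * (c * w 0)" using i n by (simp add: H_def)
    also have "\<dots> = vec_index v i" unfolding cw by (simp add: w_def)
    finally show "vec_index (H *\<^sub>v unit_vec n 0) i = vec_index v i" .
  qed (use v in \<open>simp add: H_def\<close>)
  ultimately show ?thesis using that H sym by blast
qed

text \<open>Any eigenvalue of \<open>transpose_mat D * D\<close> will do, since no ordering of the
  singular values is asked for. If it is nonzero, \<open>u\<close> is the normalised image of
  \<open>v\<close>; otherwise \<open>D\<close> and its transpose are singular and \<open>u\<close>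
  comes from the kernel of the transpose.\<close>

lemma singular_pair:
  fixes D :: "real Matrix.mat"
  assumes D: "D \<in> carrier_mat n n" and n: "n > 0"
  obtains \<sigma> u v where "\<sigma> \<ge> 0" "u \<in> carrier_vec n" "scalar_prod u u = 1" "v \<in> carrier_vec n"
    "scalar_prod v v = 1" "D *\<^sub>v v = \<sigma> \<cdot>\<^sub>v u" "transpose_mat D *\<^sub>v u = \<sigma> \<cdot>\<^sub>v v"
proof -
  let ?B = "transpose_mat D * D"
  have B: "?B \<in> carrier_mat n n" using D by simp
  obtain l where "eigenvalue ?B l"
    by (rule symmetric_real_eigenvalue[OF B _ n]) (use D in \<open>simp add: transpose_mult[of _ n n]\<close>)
  then obtain v where v: "v \<in> carrier_vec n" "scalar_prod v v = 1" "?B *\<^sub>v v = l \<cdot>\<^sub>v v"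
    "scalar_prod (D *\<^sub>v v) (D *\<^sub>v v) = l"
    using unit_eigenvector[OF D] by metis
  have l: "l \<ge> 0" using v(4) scalar_prod_self_nonneg by metis
  have Dv: "D *\<^sub>v v \<in> carrier_vec n" using D v(1) by (rule mult_mat_vec_carrier)
  show ?thesis
  proof (cases "l = 0")
    case True
    then have z: "D *\<^sub>v v = 0\<^sub>v n" using scalar_prod_self_eq_0[OF Dv] v(4) by simp
    have "v \<noteq> 0\<^sub>v n" using v(2) by auto
    then have "Determinant.det D = 0" using det_0_iff_vec_prod_zero[OF D] v(1) z by blast
    then have "Determinant.det (transpose_mat D) = 0" using det_transpose[OF D] by simp
    then obtain u where u: "u \<in> carrier_vec n" "u \<noteq> 0\<^sub>v n" "transpose_mat D *\<^sub>v u = 0\<^sub>v n"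
      using det_0_iff_vec_prod_zero[of "transpose_mat D" n] D by auto
    obtain c where c: "scalar_prod (c \<cdot>\<^sub>v u) (c \<cdot>\<^sub>v u) = 1" using normalize_vec[OF u(1,2)] .
    show ?thesis
      by (rule that[of 0 "c \<cdot>\<^sub>v u" v])
        (use c u v z D mult_mat_vec[of "transpose_mat D" n n u c] in auto)
  next
    case False
    define u where "u = (1 / sqrt l) \<cdot>\<^sub>v (D *\<^sub>v v)"
    have sl: "sqrt l > 0" "sqrt l * sqrt l = l" using l False by auto
    show ?thesis
    proof (rule that[of "sqrt l" u v])
      show "scalar_prod u u = 1" using v(4) sl l by (simp add: u_def)
      show "D *\<^sub>v v = sqrt l \<cdot>\<^sub>v u" using sl by (simp add: u_def smult_smult_assoc)
      have "transpose_mat D *\<^sub>v u = (1 / sqrt l) \<cdot>\<^sub>v (?B *\<^sub>v v)"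
        unfolding u_def using D Dv v(1) by (simp add: mult_mat_vec[of _ n n] assoc_mult_mat_vec[of _ n n _ n])
      also have "\<dots> = sqrt l \<cdot>\<^sub>v v"
        unfolding v(3) using sl l by (simp add: smult_smult_assoc real_div_sqrt)
      finally show "transpose_mat D *\<^sub>v u = sqrt l \<cdot>\<^sub>v v" .
    qed (use l v Dv in \<open>auto simp: u_def\<close>)
  qed
qed

lemma mult_unit_vec_index:
  fixes A :: "real Matrix.mat"
  assumes "A \<in> carrier_mat n m" "i < n" "j < m"
  shows "vec_index (A *\<^sub>v unit_vec m j) i = A $$ (i,j)"
  using assms by (simp add: mult_mat_vec_def)

abbreviation corner_block :: "real \<Rightarrow> real Matrix.mat \<Rightarrow> real Matrix.mat" where
  "corner_block a A \<equiv> four_block_mat (Matrix.mat 1 1 (\<lambda>_. a)) (0\<^sub>m 1 (dim_col A)) (0\<^sub>m (dim_row A) 1) A"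

lemma corner_block_mult:
  assumes "A \<in> carrier_mat n n" "B \<in> carrier_mat n n"
  shows "corner_block a A * corner_block b B = corner_block (a * b) (A * B)"
proof -
  have "Matrix.mat 1 1 (\<lambda>_. a) * Matrix.mat 1 1 (\<lambda>_. b) = Matrix.mat 1 1 (\<lambda>_. a * b)"
    by (intro eq_matI) (auto simp: scalar_prod_def)
  moreover have "corner_block a A * corner_block b B
    = four_block_mat
        (Matrix.mat 1 1 (\<lambda>_. a) * Matrix.mat 1 1 (\<lambda>_. b) + 0\<^sub>m 1 n * 0\<^sub>m n 1)
        (Matrix.mat 1 1 (\<lambda>_. a) * 0\<^sub>m 1 n + 0\<^sub>m 1 n * B)
        (0\<^sub>m n 1 * Matrix.mat 1 1 (\<lambda>_. b) + A * 0\<^sub>m n 1)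
        (0\<^sub>m n 1 * 0\<^sub>m 1 n + A * B)"
    using assms by (simp add: mult_four_block_mat[of _ 1 1 _ n _ n _ _ 1 _ n])
  ultimately show ?thesis using assms by simp
qed

lemma corner_block_orthogonal:
  assumes "V \<in> orthogonal_group n"
  shows "corner_block 1 V \<in> orthogonal_group (Suc n)"
proof -
  have V: "V \<in> carrier_mat n n" "transpose_mat V * V = 1\<^sub>m n"
    using assms by (auto simp: orthogonal_group_def)
  have "transpose_mat (corner_block 1 V) = corner_block 1 (transpose_mat V)"
    by (rule eq_matI) (use V in auto)
  then have "transpose_mat (corner_block 1 V) * corner_block 1 V = corner_block 1 (1\<^sub>m n)"
    using corner_block_mult[of "transpose_mat V" n V 1 1] V by simp
  also have "\<dots> = 1\<^sub>m (Suc n)"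
    by (rule eq_matI) auto
  finally have "transpose_mat (corner_block 1 V) * corner_block 1 V = 1\<^sub>m (Suc n)" .
  moreover have "corner_block 1 V \<in> carrier_mat (1 + n) (1 + n)"
    by (rule four_block_carrier_mat) (use V in auto)
  ultimately show ?thesis unfolding orthogonal_group_def by simp
qed

text \<open>Reflections \<open>G\<close>, \<open>H\<close> take the first unit vector to a singular
  pair. Because the pair controls both \<open>D\<close> and its transpose, the first row and the
  first column of \<open>G * D * H\<close> vanish off the diagonal, and the induction continues with
  the remaining block.\<close>

lemma singular_value_decomposition:
  fixes D :: "real Matrix.mat"
  assumes "D \<in> carrier_mat n n"
  shows "\<exists>V W d. V \<in> orthogonal_group n \<and> W \<in> orthogonal_group n \<and> (\<forall>i<n. 0 \<le> d i) \<and>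
    D = V * Matrix.mat n n (\<lambda>(i,j). diag_fun d i j) * W"
  using assms
proof (induction n arbitrary: D)
  case 0
  have "D = 1\<^sub>m 0 * Matrix.mat 0 0 (\<lambda>(i,j). diag_fun (\<lambda>_. 0) i j) * 1\<^sub>m 0"
    using 0 by (intro eq_matI) auto
  then show ?case
    by (intro exI[of _ "1\<^sub>m 0"] exI[of _ "\<lambda>_. 0"]) (auto simp: orthogonal_group_def)
next
  case (Suc n)
  note D = Suc.prems
  let ?n = "Suc n" and ?e = "unit_vec (Suc n) 0"
  obtain \<sigma> u v where s: "\<sigma> \<ge> 0" "u \<in> carrier_vec ?n" "scalar_prod u u = 1" "v \<in> carrier_vec ?n"
    "scalar_prod v v = 1" "D *\<^sub>v v = \<sigma> \<cdot>\<^sub>v u" "transpose_mat D *\<^sub>v u = \<sigma> \<cdot>\<^sub>v v"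
    using singular_pair[OF D] by blast
  obtain H where H: "H \<in> carrier_mat ?n ?n" "transpose_mat H = H" "H * H = 1\<^sub>m ?n" "H *\<^sub>v ?e = v"
    using householder[OF s(4,5)] by blast
  obtain G where G: "G \<in> carrier_mat ?n ?n" "transpose_mat G = G" "G * G = 1\<^sub>m ?n" "G *\<^sub>v ?e = u"
    using householder[OF s(2,3)] by blast
  have HO: "H \<in> orthogonal_group ?n" and GO: "G \<in> orthogonal_group ?n"
    using H G by (auto simp: orthogonal_group_def)
  have Hv: "H *\<^sub>v v = ?e" "G *\<^sub>v u = ?e"
  proof -
    have "H *\<^sub>v v = (H * H) *\<^sub>v ?e" "G *\<^sub>v u = (G * G) *\<^sub>v ?e"
      using H(1,4) G(1,4) assoc_mult_mat_vec[of H ?n ?n H ?n ?e] assoc_mult_mat_vec[of G ?n ?n G ?n ?e]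
      by simp_all
    then show "H *\<^sub>v v = ?e" "G *\<^sub>v u = ?e" unfolding H(3) G(3) by simp_all
  qed
  define M where "M = G * D * H"
  have M: "M \<in> carrier_mat ?n ?n" using G D H by (simp add: M_def)
  have Me: "M *\<^sub>v ?e = \<sigma> \<cdot>\<^sub>v ?e"
  proof -
    have "M *\<^sub>v ?e = G *\<^sub>v (D *\<^sub>v (H *\<^sub>v ?e))"
      unfolding M_def using G D H by (simp add: assoc_mult_mat_vec[of _ ?n ?n _ ?n])
    then show ?thesis using G s H Hv mult_mat_vec[of G ?n ?n u \<sigma>] by simp
  qed
  have MTe: "transpose_mat M *\<^sub>v ?e = \<sigma> \<cdot>\<^sub>v ?e"
  proof -
    have "transpose_mat M = H * (transpose_mat D * G)"
      unfolding M_def using G D H by (simp add: transpose_mult[of _ ?n ?n _ ?n])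
    then have "transpose_mat M *\<^sub>v ?e = H *\<^sub>v (transpose_mat D *\<^sub>v (G *\<^sub>v ?e))"
      using G D H by (simp add: assoc_mult_mat_vec[of _ ?n ?n _ ?n])
    then show ?thesis using G s H Hv mult_mat_vec[of H ?n ?n v \<sigma>] by simp
  qed
  have col: "M $$ (i,0) = (if i = 0 then \<sigma> else 0)" if "i < ?n" for i
    using mult_unit_vec_index[OF M that, of 0] that unfolding Me by auto
  have row: "M $$ (0,i) = (if i = 0 then \<sigma> else 0)" if "i < ?n" for i
    using mult_unit_vec_index[of "transpose_mat M" ?n ?n i 0] M that unfolding MTe by auto
  define D' where "D' = Matrix.mat n n (\<lambda>(i,j). M $$ (Suc i, Suc j))"
  have MD: "M = corner_block \<sigma> D'"
  proof (rule eq_matI)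
    fix i j assume "i < dim_row (corner_block \<sigma> D')" "j < dim_col (corner_block \<sigma> D')"
    then show "M $$ (i,j) = corner_block \<sigma> D' $$ (i,j)"
      using col[of i] row[of j] by (cases i; cases j) (auto simp: D'_def)
  qed (use M in \<open>auto simp: D'_def\<close>)
  obtain V W d where IH: "V \<in> orthogonal_group n" "W \<in> orthogonal_group n" "\<forall>i<n. 0 \<le> d i"
    "D' = V * Matrix.mat n n (\<lambda>(i,j). diag_fun d i j) * W"
    using Suc.IH[of D'] by (auto simp: D'_def)
  define S where "S = Matrix.mat n n (\<lambda>(i,j). diag_fun d i j)"
  define d' where "d' = case_nat \<sigma> d"
  have cV: "V \<in> carrier_mat n n" "W \<in> carrier_mat n n" "S \<in> carrier_mat n n"
    using IH orthogonal_group_carrier by (auto simp: S_def)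
  have "corner_block \<sigma> D' = corner_block 1 V * corner_block \<sigma> S * corner_block 1 W"
    using corner_block_mult[OF cV(1,3), of 1 \<sigma>] corner_block_mult[OF mult_carrier_mat[OF cV(1,3)] cV(2), of \<sigma> 1]
    by (simp only: IH(4) S_def[symmetric] mult_1_left mult_1_right)
  also have "corner_block \<sigma> S = Matrix.mat ?n ?n (\<lambda>(i,j). diag_fun d' i j)"
  proof (rule eq_matI)
    fix i j assume "i < dim_row (Matrix.mat ?n ?n (\<lambda>(i,j). diag_fun d' i j))"
      "j < dim_col (Matrix.mat ?n ?n (\<lambda>(i,j). diag_fun d' i j))"
    then show "corner_block \<sigma> S $$ (i,j) = Matrix.mat ?n ?n (\<lambda>(i,j). diag_fun d' i j) $$ (i,j)"
      by (cases i; cases j) (auto simp: S_def diag_fun_def d'_def)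
  qed (auto simp: S_def)
  finally have Mdec: "M = corner_block 1 V * Matrix.mat ?n ?n (\<lambda>(i,j). diag_fun d' i j) * corner_block 1 W"
    by (simp add: MD)
  define S' where "S' = Matrix.mat ?n ?n (\<lambda>(i,j). diag_fun d' i j)"
  define V' where "V' = corner_block 1 V"
  define W' where "W' = corner_block 1 W"
  have O: "V' \<in> orthogonal_group ?n" "W' \<in> orthogonal_group ?n"
    using IH corner_block_orthogonal by (auto simp: V'_def W'_def)
  have c: "V' \<in> carrier_mat ?n ?n" "W' \<in> carrier_mat ?n ?n" "S' \<in> carrier_mat ?n ?n"
    using O orthogonal_group_carrier by (auto simp: S'_def)
  have "D = G * M * H"
  proof -
    have "G * M * H = (G * G) * D * (H * H)"
      unfolding M_def using G(1) D H(1) by (simp add: assoc_mult_mat[of _ ?n ?n _ ?n _ ?n])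
    then show ?thesis unfolding G(3) H(3) using D by simp
  qed
  also have "\<dots> = G * (V' * S' * W') * H" using Mdec by (simp add: V'_def W'_def S'_def)
  also have "\<dots> = (G * V') * S' * (W' * H)"
    using G H c by (simp add: assoc_mult_mat[of _ ?n ?n _ ?n _ ?n])
  finally have "D = (G * V') * S' * (W' * H)" .
  moreover have "G * V' \<in> orthogonal_group ?n" "W' * H \<in> orthogonal_group ?n"
    using O HO GO orthogonal_group_mult by auto
  moreover have "\<forall>i<?n. 0 \<le> d' i" using IH(3) s(1) by (auto simp: d'_def split: nat.split)
  ultimately show ?case unfolding S'_def by blast
qed

section \<open>Norm estimates after diagonalisation\<close>

lemma scalar_prod_self_L2_set:
  fixes x :: "real Matrix.vec"
  assumes "x \<in> carrier_vec n"
  shows "sqrt (scalar_prod x x) = L2_set (vec_index x) {..<n}"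
  using assms by (simp add: L2_set_def scalar_prod_def atLeast0LessThan power2_eq_square)

lemma mult_mat_vec_sum:
  fixes A :: "real Matrix.mat"
  assumes "A \<in> carrier_mat n n" "x \<in> carrier_vec n" "i < n"
  shows "vec_index (A *\<^sub>v x) i = (\<Sum>j<n. A $$ (i,j) * vec_index x j)"
  using assms by (auto simp: scalar_prod_def atLeast0LessThan intro!: sum.cong)

lemma L2_set_orthogonal:
  assumes "U \<in> orthogonal_group n"
  shows "L2_set (\<lambda>i. \<Sum>j<n. U $$ (i,j) * x j) {..<n} = L2_set x {..<n}"
proof -
  define v where "v = Matrix.vec n x"
  have v: "v \<in> carrier_vec n" by (simp add: v_def)
  have U: "U \<in> carrier_mat n n" using assms by (rule orthogonal_group_carrier)
  have "L2_set (\<lambda>i. \<Sum>j<n. U $$ (i,j) * x j) {..<n} = L2_set (vec_index (U *\<^sub>v v)) {..<n}"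
  proof (rule L2_set_cong)
    fix i assume "i \<in> {..<n}"
    then show "(\<Sum>j<n. U $$ (i,j) * x j) = vec_index (U *\<^sub>v v) i"
      using mult_mat_vec_sum[OF U v, of i] by (simp only: lessThan_iff) (simp add: v_def)
  qed simp
  also have "\<dots> = L2_set (vec_index v) {..<n}"
    using scalar_prod_self_L2_set[OF mult_mat_vec_carrier[OF U v]] scalar_prod_self_L2_set[OF v]
      scalar_prod_orthogonal[OF assms v] by simp
  also have "\<dots> = L2_set x {..<n}"
    by (rule L2_set_cong) (simp_all add: v_def)
  finally show ?thesis .
qed

text \<open>\<open>D + U\<close> is \<open>V * (S + U') * W\<close> with orthogonal outer factors,
  so the condition becomes one on \<open>U'\<close>, which has the same law as \<open>U\<close>
  under Haar measure.\<close>

lemma s_min_svd_witness: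
  fixes D :: "real Matrix.mat"
  assumes VW: "V \<in> orthogonal_group n" "W \<in> orthogonal_group n" and U: "U \<in> carrier_mat n n"
    and D: "D = V * Matrix.mat n n (\<lambda>(i,j). diag_fun d i j) * W"
    and n: "n > 0" and s: "s_min (D + U) \<le> t"
  defines "U' \<equiv> transpose_mat V * U * transpose_mat W"
  obtains x where "L2_set x {..<n} = 1"
    "L2_set (\<lambda>i. d i * x i + (\<Sum>j<n. U' $$ (i,j) * x j)) {..<n} \<le> t"
proof -
  define S where "S = Matrix.mat n n (\<lambda>(i,j). diag_fun d i j)"
  have c: "V \<in> carrier_mat n n" "W \<in> carrier_mat n n" "S \<in> carrier_mat n n" "U' \<in> carrier_mat n n"
    "transpose_mat V \<in> carrier_mat n n" "transpose_mat W \<in> carrier_mat n n"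
    using orthogonal_group_carrier[OF VW(1)] orthogonal_group_carrier[OF VW(2)] U
    by (auto simp: S_def U'_def)
  have inv: "V * transpose_mat V = 1\<^sub>m n" "transpose_mat W * W = 1\<^sub>m n"
    using orthogonal_group_transpose[OF VW(1)] VW(2) by (auto simp: orthogonal_group_def)
  have "V * U' * W = (V * transpose_mat V) * U * (transpose_mat W * W)"
    unfolding U'_def using c U by (simp add: assoc_mult_mat[of _ n n _ n _ n])
  then have "V * U' * W = U" unfolding inv using U by simp
  then have DU: "D + U = V * (S + U') * W"
    using c by (simp add: D S_def[symmetric] mult_add_distrib_mat[of _ n n] add_mult_distrib_mat[of _ n n])
  obtain x0 where x0: "x0 \<in> carrier_vec n" "scalar_prod x0 x0 = 1"
    "sqrt (scalar_prod ((D + U) *\<^sub>v x0) ((D + U) *\<^sub>v x0)) \<le> t"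
    by (rule s_min_le_witness[OF _ n s]) (use c U D in auto)
  define X where "X = W *\<^sub>v x0"
  have X: "X \<in> carrier_vec n" using c x0 by (simp add: X_def)
  have "S + U' \<in> carrier_mat n n" using c by simp
  note R = this mult_mat_vec_carrier[OF this X]
  have "(D + U) *\<^sub>v x0 = V *\<^sub>v ((S + U') *\<^sub>v X)"
    unfolding DU X_def using c x0 by (simp add: assoc_mult_mat_vec[of _ n n _ n])
  then have 1: "L2_set (vec_index ((S + U') *\<^sub>v X)) {..<n} \<le> t"
    using x0(3) scalar_prod_orthogonal[OF VW(1) R(2)] scalar_prod_self_L2_set[OF R(2)] by simp
  have 2: "L2_set (vec_index X) {..<n} = 1"
    using scalar_prod_self_L2_set[OF X] scalar_prod_orthogonal[OF VW(2) x0(1)] x0(2) by (simp add: X_def)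
  have "L2_set (vec_index ((S + U') *\<^sub>v X)) {..<n}
      = L2_set (\<lambda>i. d i * vec_index X i + (\<Sum>j<n. U' $$ (i,j) * vec_index X j)) {..<n}"
  proof (rule L2_set_cong)
    fix i assume "i \<in> {..<n}"
    then have i: "i < n" by simp
    have "vec_index ((S + U') *\<^sub>v X) i
        = (\<Sum>j<n. (if i = j then d i * vec_index X j else 0) + U' $$ (i,j) * vec_index X j)"
      unfolding mult_mat_vec_sum[OF R(1) X i]
      using i c by (intro sum.cong refl) (auto simp: S_def diag_fun_def algebra_simps)
    then show "vec_index ((S + U') *\<^sub>v X) i
        = d i * vec_index X i + (\<Sum>j<n. U' $$ (i,j) * vec_index X j)"
      using i by (simp add: sum.distrib)
  qed simp
  then show ?thesis using that[OF 2] 1 by simp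
qed

text \<open>The image of \<open>x\<close> under \<open>U\<close> has norm 1, that under the diagonal
  matrix has norm at most 1 - \<epsilon> or at least 1 + \<epsilon>, and the triangle inequality
  keeps their sum away from 0.\<close>

lemma no_small_image_if_same_side:
  assumes U: "U \<in> orthogonal_group n" and x: "L2_set x {..<n} = 1"
    and \<epsilon>: "0 \<le> \<epsilon>" and d: "\<And>i. i < n \<Longrightarrow> 0 \<le> d i"
    and side: "(\<forall>i<n. d i \<le> 1 - \<epsilon>) \<or> (\<forall>i<n. 1 + \<epsilon> \<le> d i)"
  shows "\<epsilon> \<le> L2_set (\<lambda>i. d i * x i + (\<Sum>j<n. U $$ (i,j) * x j)) {..<n}"
proof -
  define u where "u = (\<lambda>i. \<Sum>j<n. U $$ (i,j) * x j)"
  have u: "L2_set u {..<n} = 1" unfolding u_def using L2_set_orthogonal[OF U] x by simp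
  have neg: "L2_set (\<lambda>i. - f i) A = L2_set f A" for f :: "nat \<Rightarrow> real" and A
    by (simp add: L2_set_def)
  have absL: "L2_set f A = L2_set (\<lambda>i. \<bar>f i\<bar>) A" for f :: "nat \<Rightarrow> real" and A
    by (simp add: L2_set_def)
  have scale: "L2_set (\<lambda>i. c * \<bar>x i\<bar>) {..<n} = c" if "c \<ge> 0" for c
    using that x absL[of x] by (simp add: L2_set_right_distrib[symmetric])
  have t1: "L2_set u {..<n} \<le> L2_set (\<lambda>i. d i * x i + u i) {..<n} + L2_set (\<lambda>i. d i * x i) {..<n}"
    using L2_set_triangle_ineq[of "\<lambda>i. d i * x i + u i" "\<lambda>i. - (d i * x i)" "{..<n}"] by (simp add: neg)
  have t2: "L2_set (\<lambda>i. d i * x i) {..<n} \<le> L2_set (\<lambda>i. d i * x i + u i) {..<n} + L2_set u {..<n}"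
    using L2_set_triangle_ineq[of "\<lambda>i. d i * x i + u i" "\<lambda>i. - u i" "{..<n}"] by (simp add: neg)
  from side have "\<epsilon> \<le> L2_set (\<lambda>i. d i * x i + u i) {..<n}"
  proof
    assume a: "\<forall>i<n. d i \<le> 1 - \<epsilon>"
    have "n \<noteq> 0" using x by (cases n) auto
    then have e: "0 \<le> 1 - \<epsilon>" using a d[of 0] by force
    have "L2_set (\<lambda>i. d i * x i) {..<n} \<le> L2_set (\<lambda>i. (1 - \<epsilon>) * \<bar>x i\<bar>) {..<n}"
      unfolding absL[of "\<lambda>i. d i * x i"] abs_mult
      by (rule L2_set_mono) (use a d in \<open>auto intro!: mult_right_mono\<close>)
    then show "\<epsilon> \<le> L2_set (\<lambda>i. d i * x i + u i) {..<n}" using t1 u scale[OF e] by linarith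
  next
    assume a: "\<forall>i<n. 1 + \<epsilon> \<le> d i"
    have "L2_set (\<lambda>i. (1 + \<epsilon>) * \<bar>x i\<bar>) {..<n} \<le> L2_set (\<lambda>i. d i * x i) {..<n}"
      unfolding absL[of "\<lambda>i. d i * x i"] abs_mult
      by (rule L2_set_mono) (use a d \<epsilon> in \<open>auto intro!: mult_right_mono\<close>)
    then show "\<epsilon> \<le> L2_set (\<lambda>i. d i * x i + u i) {..<n}" using t2 u scale[of "1 + \<epsilon>"] \<epsilon> by linarith
  qed
  then show ?thesis by (simp only: u_def)
qed

lemma op_norm_bounds:
  fixes A :: "real Matrix.mat"
  assumes A: "A \<in> carrier_mat n n"
  shows "bdd_above ((\<lambda>x. l2_norm_vec (A *\<^sub>v x)) ` {x \<in> carrier_vec (dim_col A). l2_norm_vec x \<le> 1})"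
    and "x \<in> carrier_vec n \<Longrightarrow> l2_norm_vec x \<le> 1 \<Longrightarrow> l2_norm_vec (A *\<^sub>v x) \<le> op_norm A"
    and "0 \<le> op_norm A"
proof -
  have b: "l2_norm_vec (A *\<^sub>v x) \<le> sqrt (\<Sum>i<n. \<Sum>j<n. (A $$ (i,j))\<^sup>2)"
    if x: "x \<in> carrier_vec n" "l2_norm_vec x \<le> 1" for x
  proof -
    have x1: "(\<Sum>j<n. (vec_index x j)\<^sup>2) \<le> 1"
      using x by (simp add: l2_norm_vec_def scalar_prod_def atLeast0LessThan power2_eq_square)
    have "(\<Sum>i<n. (vec_index (A *\<^sub>v x) i)\<^sup>2) \<le> (\<Sum>i<n. \<Sum>j<n. (A $$ (i,j))\<^sup>2)"
    proof (rule sum_mono)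
      fix i assume "i \<in> {..<n}"
      then have "(vec_index (A *\<^sub>v x) i)\<^sup>2 = (\<Sum>j<n. A $$ (i,j) * vec_index x j)\<^sup>2"
        using mult_mat_vec_sum[OF A x(1)] by simp
      also have "\<dots> \<le> (\<Sum>j<n. (A $$ (i,j))\<^sup>2) * (\<Sum>j<n. (vec_index x j)\<^sup>2)"
        by (rule Cauchy_Schwarz_ineq_sum)
      also have "\<dots> \<le> (\<Sum>j<n. (A $$ (i,j))\<^sup>2) * 1"
        using x1 by (intro mult_left_mono sum_nonneg) auto
      finally show "(vec_index (A *\<^sub>v x) i)\<^sup>2 \<le> (\<Sum>j<n. (A $$ (i,j))\<^sup>2)" by simp
    qed
    then show ?thesis
      using scalar_prod_self_L2_set[OF mult_mat_vec_carrier[OF A x(1)]]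
      by (simp add: l2_norm_vec_def L2_set_def)
  qed
  have dim: "dim_col A = n" using A by simp
  show bdd: "bdd_above ((\<lambda>x. l2_norm_vec (A *\<^sub>v x)) ` {x \<in> carrier_vec (dim_col A). l2_norm_vec x \<le> 1})"
    using b unfolding dim by (intro bdd_aboveI2) auto
  show le: "l2_norm_vec (A *\<^sub>v x) \<le> op_norm A" if "x \<in> carrier_vec n" "l2_norm_vec x \<le> 1" for x
    unfolding op_norm_def by (rule cSUP_upper[OF _ bdd]) (use that dim in auto)
  have "0 \<le> l2_norm_vec (A *\<^sub>v 0\<^sub>v n)" by (simp add: l2_norm_vec_def scalar_prod_self_nonneg)
  also have "\<dots> \<le> op_norm A" by (rule le) (simp_all add: l2_norm_vec_def)
  finally show "0 \<le> op_norm A" .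
qed

text \<open>Stated for \<open>d\<close> of arbitrary sign so that it also covers
  \<open>D - V * W\<close>, whose diagonal part has the entries \<open>d i - 1\<close>.\<close>

lemma svd_op_norm:
  fixes D :: "real Matrix.mat"
  assumes VW: "V \<in> orthogonal_group n" "W \<in> orthogonal_group n"
    and D: "D = V * Matrix.mat n n (\<lambda>(i,j). diag_fun d i j) * W"
  shows "i < n \<Longrightarrow> \<bar>d i\<bar> \<le> op_norm D"
    and "0 \<le> m \<Longrightarrow> (\<And>i. i < n \<Longrightarrow> \<bar>d i\<bar> \<le> m) \<Longrightarrow> op_norm D \<le> m"
proof -
  define S where "S = Matrix.mat n n (\<lambda>(i,j). diag_fun d i j)"
  have c: "V \<in> carrier_mat n n" "W \<in> carrier_mat n n" "S \<in> carrier_mat n n" "D \<in> carrier_mat n n"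
    using orthogonal_group_carrier[OF VW(1)] orthogonal_group_carrier[OF VW(2)]
    by (auto simp: S_def D)
  have norm: "l2_norm_vec (D *\<^sub>v x) = L2_set (\<lambda>i. d i * vec_index (W *\<^sub>v x) i) {..<n}"
    if x: "x \<in> carrier_vec n" for x
  proof -
    have X: "W *\<^sub>v x \<in> carrier_vec n" using c x by simp
    have SX: "S *\<^sub>v (W *\<^sub>v x) \<in> carrier_vec n" using c X by simp
    have "D *\<^sub>v x = V *\<^sub>v (S *\<^sub>v (W *\<^sub>v x))"
      unfolding D S_def[symmetric] using c x by (simp add: assoc_mult_mat_vec[of _ n n _ n])
    then have "l2_norm_vec (D *\<^sub>v x) = L2_set (vec_index (S *\<^sub>v (W *\<^sub>v x))) {..<n}"
      using scalar_prod_orthogonal[OF VW(1) SX] scalar_prod_self_L2_set[OF SX] by (simp add: l2_norm_vec_def)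
    also have "\<dots> = L2_set (\<lambda>i. d i * vec_index (W *\<^sub>v x) i) {..<n}"
    proof (rule L2_set_cong)
      fix i assume "i \<in> {..<n}"
      then have i: "i < n" by simp
      have "vec_index (S *\<^sub>v (W *\<^sub>v x)) i = (\<Sum>j<n. if i = j then d i * vec_index (W *\<^sub>v x) j else 0)"
        unfolding mult_mat_vec_sum[OF c(3) X i] using i by (intro sum.cong refl) (auto simp: S_def diag_fun_def)
      then show "vec_index (S *\<^sub>v (W *\<^sub>v x)) i = d i * vec_index (W *\<^sub>v x) i" using i by simp
    qed simp
    finally show ?thesis .
  qed
  have nW: "l2_norm_vec x = L2_set (vec_index (W *\<^sub>v x)) {..<n}" if x: "x \<in> carrier_vec n" for x
    using scalar_prod_orthogonal[OF VW(2) x] scalar_prod_self_L2_set[OF mult_mat_vec_carrier[OF c(2) x]]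
    by (simp add: l2_norm_vec_def)
  show "\<bar>d i\<bar> \<le> op_norm D" if i: "i < n"
  proof -
    define x where "x = transpose_mat W *\<^sub>v unit_vec n i"
    have x: "x \<in> carrier_vec n" using c by (simp add: x_def)
    have "W * transpose_mat W = 1\<^sub>m n"
      using orthogonal_group_transpose[OF VW(2)] by (simp add: orthogonal_group_def)
    moreover have "W *\<^sub>v x = (W * transpose_mat W) *\<^sub>v unit_vec n i"
      unfolding x_def using c by (simp add: assoc_mult_mat_vec[of _ n n _ n])
    ultimately have Wx: "W *\<^sub>v x = unit_vec n i" by simp
    have uv: "vec_index (unit_vec n i :: real Matrix.vec) j = (if j = i then 1 else 0)" if "j < n" for j
      using i that by simp
    have L: "L2_set (\<lambda>j. c * (if j = i then 1 else 0)) {..<n} = \<bar>c\<bar>" for c :: real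
    proof -
      have "(\<Sum>j<n. (c * (if j = i then 1 else 0))\<^sup>2) = (\<Sum>j<n. if j = i then c\<^sup>2 else 0)"
        by (intro sum.cong) auto
      then show ?thesis using i by (simp add: L2_set_def)
    qed
    have "l2_norm_vec x = L2_set (\<lambda>j. 1 * (if j = i then 1 else 0)) {..<n}"
      unfolding nW[OF x] Wx by (rule L2_set_cong) (simp_all add: uv)
    then have "l2_norm_vec x \<le> 1" unfolding L by simp
    moreover have "l2_norm_vec (D *\<^sub>v x) = L2_set (\<lambda>j. d i * (if j = i then 1 else 0)) {..<n}"
      unfolding norm[OF x] Wx by (rule L2_set_cong) (auto simp: uv)
    ultimately show ?thesis using op_norm_bounds(2)[OF c(4) x] L by simp
  qed
  show "op_norm D \<le> m" if m: "0 \<le> m" "\<And>i. i < n \<Longrightarrow> \<bar>d i\<bar> \<le> m"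
    unfolding op_norm_def
  proof (rule cSUP_least)
    show "{x \<in> carrier_vec (dim_col D). l2_norm_vec x \<le> 1} \<noteq> {}"
      by (auto intro!: exI[of _ "0\<^sub>v (dim_col D)"] simp: l2_norm_vec_def)
    fix x assume "x \<in> {x \<in> carrier_vec (dim_col D). l2_norm_vec x \<le> 1}"
    then have x: "x \<in> carrier_vec n" "l2_norm_vec x \<le> 1" using c by auto
    let ?y = "vec_index (W *\<^sub>v x)"
    have "L2_set (\<lambda>i. d i * ?y i) {..<n} = L2_set (\<lambda>i. \<bar>d i\<bar> * \<bar>?y i\<bar>) {..<n}"
      by (simp add: L2_set_def power_mult_distrib)
    also have "\<dots> \<le> L2_set (\<lambda>i. m * \<bar>?y i\<bar>) {..<n}"
      by (rule L2_set_mono) (use m in \<open>auto intro!: mult_right_mono\<close>)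
    also have "\<dots> = m * L2_set ?y {..<n}"
      using m by (simp add: L2_set_right_distrib[symmetric]) (simp add: L2_set_def)
    also have "\<dots> \<le> m" using nW[OF x(1)] x(2) m by (simp add: mult_left_le)
    finally show "l2_norm_vec (D *\<^sub>v x) \<le> m" unfolding norm[OF x(1)] .
  qed
qed

text \<open>\<open>V * W\<close> is a competitor in the infimum, and its distance from
  \<open>D\<close> is at most the largest |d i - 1|.\<close>

lemma exists_singular_value_away_from_1:
  fixes D :: "real Matrix.mat"
  assumes VW: "V \<in> orthogonal_group n" "W \<in> orthogonal_group n"
    and D: "D = V * Matrix.mat n n (\<lambda>(i,j). diag_fun d i j) * W"
    and \<delta>: "0 < \<delta>" "\<delta> \<le> (INF V\<in>orthogonal_group n. op_norm (D - V))"
  obtains i where "i < n" "\<delta> \<le> \<bar>d i - 1\<bar>"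
proof -
  assume away: "\<And>i. i < n \<Longrightarrow> \<delta> \<le> \<bar>d i - 1\<bar> \<Longrightarrow> thesis"
  define S where "S = Matrix.mat n n (\<lambda>(i,j). diag_fun d i j)"
  define S1 where "S1 = Matrix.mat n n (\<lambda>(i,j). diag_fun (\<lambda>i. d i - 1) i j)"
  have c: "V \<in> carrier_mat n n" "W \<in> carrier_mat n n" "S \<in> carrier_mat n n"
    using VW orthogonal_group_carrier by (auto simp: S_def)
  have S1: "S - 1\<^sub>m n = S1" by (rule eq_matI) (auto simp: S_def S1_def diag_fun_def)
  have "D - V * W = V * (S - 1\<^sub>m n) * W"
    unfolding D S_def[symmetric] using c
    by (simp add: mult_minus_distrib_mat[of _ n n] minus_mult_distrib_mat[of _ n n])
  then have DV: "D - V * W = V * S1 * W" by (simp add: S1)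
  have "(INF V\<in>orthogonal_group n. op_norm (D - V)) \<le> op_norm (D - V * W)"
  proof (rule cINF_lower)
    show "bdd_below ((\<lambda>V. op_norm (D - V)) ` orthogonal_group n)"
    proof (rule bdd_belowI2)
      fix V' assume "V' \<in> orthogonal_group n"
      then show "0 \<le> op_norm (D - V')"
        by (intro op_norm_bounds(3)[of "D - V'" n] minus_carrier_mat orthogonal_group_carrier)
    qed
  qed (rule orthogonal_group_mult[OF VW])
  then have le: "\<delta> \<le> op_norm (D - V * W)" using \<delta> by simp
  show thesis
  proof (rule ccontr)
    assume no: "\<not> thesis"
    have small: "\<bar>d i - 1\<bar> < \<delta>" if "i < n" for i
    proof (rule ccontr)
      assume "\<not> \<bar>d i - 1\<bar> < \<delta>"
      then have "\<delta> \<le> \<bar>d i - 1\<bar>" by simp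
      with \<open>i < n\<close> no away show False by blast
    qed
    \<comment> \<open>The maximum over finitely many values keeps the inequality with \<delta>
      strict; the inserted 0 gives the nonnegativity that \<open>svd_op_norm\<close> asks
      for.\<close>
    define m where "m = Max (insert 0 ((\<lambda>i. \<bar>d i - 1\<bar>) ` {..<n}))"
    have "m < \<delta>" unfolding m_def using small \<delta> by (subst Max_less_iff) auto
    moreover have "op_norm (D - V * W) \<le> m"
      by (rule svd_op_norm(2)[OF VW DV[unfolded S1_def]]) (auto simp: m_def)
    ultimately show False using le by simp
  qed
qed

subsection \<open>From a near-kernel vector to small determinants\<close>

text \<open>Cramer's rule with row \<open>j\<close> of \<open>U\<close> writes \<open>w j\<close>
  times the determinant as a sum of n products, each of a factor at most \<open>t\<close> and a
  numerator bounded by \<open>numerator_bound\<close>. Choosing \<open>j\<close> with |w j| at least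
  1/n and dividing by the determinant leaves a lower bound for \<open>t\<close>.\<close>

lemma near_kernel_vector_bound:
  fixes d :: "nat \<Rightarrow> real"
  assumes n: "n > 0" and U: "U \<in> orthogonal_group n"
    and d: "\<And>i. i < n \<Longrightarrow> 0 \<le> d i \<and> d i \<le> K"
    and g: "0 < g" "g \<le> K"
    and gap: "p < n" "q < n" "\<bar>d p - d q\<bar> \<ge> 4 * g"
    and x: "L2_set x {..<n} = 1"
    and small: "L2_set (\<lambda>i. d i * x i + (\<Sum>j<n. U $$ (i,j) * x j)) {..<n} \<le> t"
    and nz: "sum_det n (diag_fun d) (\<lambda>i j. U $$ (i,j)) \<noteq> 0"
    and reachable: "\<And>Y. Y \<in> reachable n 7 (diag_fun d) \<Longrightarrow>
      \<bar>sum_det n Y (\<lambda>i j. U $$ (i,j))\<bar> \<le> L * \<bar>sum_det n (diag_fun d) (\<lambda>i j. U $$ (i,j))\<bar>"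
  shows "1 \<le> (real n)\<^sup>2 * t * (3 * K / g * L)"
proof -
  define u where "u = (\<lambda>i j. U $$ (i,j))"
  define r where "r = (\<lambda>i j. diag_fun d i j + u i j)"
  define w where "w = (\<lambda>i. \<Sum>j<n. u i j * x j)"
  define F where "F = \<bar>rdet n r\<bar>"
  have F: "F > 0" "F = \<bar>sum_det n (diag_fun d) u\<bar>" using nz by (auto simp: F_def r_def sum_det_def u_def)
  have t: "0 \<le> t" using small L2_set_nonneg order.trans by blast
  have "L2_set w {..<n} = 1"
    using L2_set_orthogonal[OF U, of x] x by (simp add: w_def u_def)
  then have w1: "(\<Sum>i<n. (w i)\<^sup>2) = 1" by (simp add: L2_set_def)
  obtain j where j: "j < n" "1 / real n \<le> \<bar>w j\<bar>"
  proof (rule ccontr)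
    assume no: "\<not> thesis"
    have "(w i)\<^sup>2 < 1 / real n" if "i < n" for i
    proof -
      have "\<bar>w i\<bar> < 1 / real n" using that no \<open>\<And>j. \<lbrakk>j < n; 1 / real n \<le> \<bar>w j\<bar>\<rbrakk> \<Longrightarrow> thesis\<close> by force
      then have "(w i)\<^sup>2 < (1 / real n)\<^sup>2" by (metis abs_ge_zero power2_abs power_strict_mono pos2)
      also have "\<dots> \<le> 1 / real n" using n by (simp add: power2_eq_square field_simps)
      finally show ?thesis .
    qed
    then have "(\<Sum>i<n. (w i)\<^sup>2) < (\<Sum>i<n. 1 / real n)"
      using n by (intro sum_strict_mono) auto
    then show False using w1 n by simp
  qed
  have row: "(\<Sum>l<n. r k l * x l) = d k * x k + w k" if "k < n" for k
  proof -
    have "(\<Sum>l<n. r k l * x l) = (\<Sum>l<n. (if k = l then d k * x l else 0) + u k l * x l)"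
      by (intro sum.cong refl) (auto simp: r_def diag_fun_def algebra_simps)
    then show ?thesis using that by (simp add: sum.distrib w_def)
  qed
  have y: "\<bar>d k * x k + w k\<bar> \<le> t" if "k < n" for k
  proof -
    have "\<bar>d k * x k + w k\<bar> \<le> L2_set (\<lambda>i. \<bar>d i * x i + w i\<bar>) {..<n}"
      using that by (intro member_le_L2_set) auto
    then show ?thesis using small by (simp add: L2_set_def w_def u_def)
  qed
  have num: "\<bar>rdet n (r(k := u j))\<bar> \<le> 3 * K / g * (L * F)" if "k < n" for k
    unfolding r_def
    by (rule numerator_bound[OF d g gap _ j(1) that]) (use reachable[folded u_def] F(2) in auto)
  have "1 / real n * F \<le> \<bar>w j\<bar> * F" using j F by (intro mult_right_mono) auto
  also have "\<dots> = \<bar>\<Sum>k<n. (\<Sum>l<n. r k l * x l) * rdet n (r(k := u j))\<bar>"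
    unfolding rdet_cramer[symmetric] by (simp add: abs_mult F_def w_def)
  also have "\<dots> \<le> (\<Sum>k<n. \<bar>(\<Sum>l<n. r k l * x l) * rdet n (r(k := u j))\<bar>)"
    by (rule sum_abs)
  also have "\<dots> \<le> (\<Sum>k<n. t * (3 * K / g * (L * F)))"
    unfolding abs_mult
  proof (intro sum_mono mult_mono)
    fix k assume "k \<in> {..<n}"
    then have k: "k < n" by simp
    show "\<bar>\<Sum>l<n. r k l * x l\<bar> \<le> t" using row[OF k] y[OF k] by simp
    show "\<bar>rdet n (r(k := u j))\<bar> \<le> 3 * K / g * (L * F)" by (rule num[OF k])
  qed (use t in auto)
  also have "\<dots> = real n * t * (3 * K / g * L) * F" by simp
  finally have "1 / real n * F \<le> real n * t * (3 * K / g * L) * F" .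
  then have "1 / real n \<le> real n * t * (3 * K / g * L)" using F(1) by (rule mult_right_le_imp_le)
  then have "real n * (1 / real n) \<le> real n * (real n * t * (3 * K / g * L))"
    by (rule mult_left_mono) simp
  then show ?thesis using n by (simp add: power2_eq_square mult.assoc)
qed

text \<open>As a function of the shift, the determinant is the characteristic polynomial of the
  negative of the unshifted matrix, hence has at most n roots.\<close>

lemma card_singular_shifts:
  fixes U :: "real Matrix.mat"
  assumes U: "U \<in> carrier_mat n n" and J: "finite J" "inj_on h J"
  shows "card {i \<in> J. sum_det n (diag_fun (\<lambda>k. d k + h i)) (\<lambda>i j. U $$ (i,j)) = 0} \<le> n"
proof -
  define R where "R = Matrix.mat n n (\<lambda>(i,j). - (diag_fun d i j + U $$ (i,j)))"
  have R: "R \<in> carrier_mat n n" by (simp add: R_def)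
  have deg: "degree (char_poly R) = n" "char_poly R \<noteq> 0"
    using degree_monic_char_poly[OF R] by auto
  have "sum_det n (diag_fun (\<lambda>k. d k + c)) (\<lambda>i j. U $$ (i,j)) = poly (char_poly R) c" for c
    unfolding char_poly_matrix[OF R] sum_det_def rdet_def
    by (rule arg_cong[of _ _ Determinant.det], rule eq_matI)
      (auto simp: R_def char_matrix_def diag_fun_def)
  then have "{i \<in> J. sum_det n (diag_fun (\<lambda>k. d k + h i)) (\<lambda>i j. U $$ (i,j)) = 0}
      = {i \<in> J. h i \<in> {c. poly (char_poly R) c = 0}}" by simp
  moreover have "card {i \<in> J. h i \<in> {c. poly (char_poly R) c = 0}} \<le> card {c. poly (char_poly R) c = 0}"
    by (rule card_inj_on_le[of h]) (use J poly_roots_finite[OF deg(2)] in \<open>auto intro: inj_on_subset\<close>)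
  moreover have "\<dots> \<le> n" using poly_roots_degree[OF deg(2)] deg(1) by simp
  ultimately show ?thesis by simp
qed

context haar_orthogonal
begin

text \<open>\<open>T\<close> is enclosed in an event \<open>E\<close> instead of being shown
  measurable. \<open>E\<close> collects the zero set of the determinant and the failures of the
  comparison for each reachable \<open>Y\<close>; each failure has probability at most 2 * 7 /
  N.\<close>

lemma prob_small_image_generic:
  assumes n: "n > 0" and N: "N > 0"
    and d: "\<And>i. i < n \<Longrightarrow> 0 \<le> d i \<and> d i \<le> K"
    and g: "0 < g" "g \<le> K"
    and gap: "p < n" "q < n" "\<bar>d p - d q\<bar> \<ge> 4 * g"
    and t: "(real n)\<^sup>2 * t * (3 * K / g * (200 * (real N)\<^sup>2) ^ 7) < 1"
  defines "T \<equiv> {U \<in> space \<mu>. \<exists>x. L2_set x {..<n} = 1 \<and>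
      L2_set (\<lambda>i. d i * x i + (\<Sum>j<n. U $$ (i,j) * x j)) {..<n} \<le> t}"
  obtains E where "E \<in> events" "T \<subseteq> E"
    "prob E \<le> prob {U \<in> space \<mu>. sum_det_mat (diag_fun d) U = 0} + (1 + 3 * (real n)\<^sup>2) ^ 7 * (14 / N)"
proof -
  let ?L = "(200 * (real N)\<^sup>2) ^ 7"
  define Z where "Z = {U \<in> space \<mu>. sum_det_mat (diag_fun d) U = 0}"
  define B where "B = (\<lambda>Y. {U \<in> space \<mu>. ?L * \<bar>sum_det_mat (diag_fun d) U\<bar> < \<bar>sum_det_mat Y U\<bar>})"
  note fin = finite_card_reachable[of n 7 "diag_fun d"]
  have meas: "Z \<in> events" "B Y \<in> events" for Y unfolding Z_def B_def by measurable
  have UB: "(\<Union>Y\<in>reachable n 7 (diag_fun d). B Y) \<in> events"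
    using fin meas by auto
  have sub: "T \<subseteq> Z \<union> (\<Union>Y\<in>reachable n 7 (diag_fun d). B Y)"
  proof
    fix U assume "U \<in> T"
    then obtain x where U: "U \<in> space \<mu>" and x: "L2_set x {..<n} = 1"
      "L2_set (\<lambda>i. d i * x i + (\<Sum>j<n. U $$ (i,j) * x j)) {..<n} \<le> t"
      unfolding T_def by blast
    show "U \<in> Z \<union> (\<Union>Y\<in>reachable n 7 (diag_fun d). B Y)"
    proof (rule ccontr)
      assume a: "U \<notin> Z \<union> (\<Union>Y\<in>reachable n 7 (diag_fun d). B Y)"
      then have nz: "sum_det_mat (diag_fun d) U \<noteq> 0" using U by (auto simp: Z_def)
      have le: "\<bar>sum_det_mat Y U\<bar> \<le> ?L * \<bar>sum_det_mat (diag_fun d) U\<bar>" if "Y \<in> reachable n 7 (diag_fun d)" for Y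
      proof -
        have "U \<notin> B Y" using a that by blast
        then show ?thesis using U unfolding B_def by (simp only: mem_Collect_eq not_less) simp
      qed
      have "1 \<le> (real n)\<^sup>2 * t * (3 * K / g * ?L)"
        by (rule near_kernel_vector_bound[OF n _ d g gap x nz le]) (use U in \<open>simp_all add: space_haar\<close>)
      then show False using t by linarith
    qed
  qed
  have "prob (Z \<union> (\<Union>Y\<in>reachable n 7 (diag_fun d). B Y)) \<le> prob Z + prob (\<Union>Y\<in>reachable n 7 (diag_fun d). B Y)"
    using meas UB by (intro measure_Un_le) auto
  also have "prob (\<Union>Y\<in>reachable n 7 (diag_fun d). B Y) \<le> (\<Sum>Y\<in>reachable n 7 (diag_fun d). prob (B Y))"
    using fin meas by (intro finite_measure_subadditive_finite) auto
  also have "\<dots> \<le> (\<Sum>Y\<in>reachable n 7 (diag_fun d). 14 / N)"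
  proof (rule sum_mono)
    fix Y assume Y: "Y \<in> reachable n 7 (diag_fun d)"
    show "prob (B Y) \<le> 14 / N" using prob_reachable_step[OF N Y] by (simp add: B_def)
  qed
  also have "\<dots> = real (card (reachable n 7 (diag_fun d))) * (14 / N)" by simp
  also have "\<dots> \<le> (1 + 3 * (real n)\<^sup>2) ^ 7 * (14 / N)"
  proof (rule mult_right_mono)
    have "real (card (reachable n 7 (diag_fun d))) \<le> real ((1 + 3 * n\<^sup>2) ^ 7)" using fin by (intro of_nat_mono) simp
    then show "real (card (reachable n 7 (diag_fun d))) \<le> (1 + 3 * (real n)\<^sup>2) ^ 7" by simp
  qed simp
  finally have "prob (Z \<union> (\<Union>Y\<in>reachable n 7 (diag_fun d). B Y)) \<le> prob Z + (1 + 3 * (real n)\<^sup>2) ^ 7 * (14 / N)"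
    by simp
  then show ?thesis
    using that[OF sets.Un[OF meas(1) UB] sub] by (simp only: Z_def)
qed

text \<open>A generic small shift of \<open>d\<close> makes the matrix almost surely invertible, up to an
  arbitrarily small probability: for fixed \<open>U\<close> at most \<open>n\<close> shifts are singular.\<close>

lemma prob_small_image:
  assumes n: "n > 0" and N: "N > 0" and t: "0 < t" "t \<le> 1"
    and d: "\<And>i. i < n \<Longrightarrow> 0 \<le> d i \<and> d i \<le> K"
    and g: "0 < g" "g \<le> K"
    and gap: "p < n" "q < n" "\<bar>d p - d q\<bar> \<ge> 4 * g"
    and small: "(real n)\<^sup>2 * (2 * t) * (3 * (K + 1) / g * (200 * (real N)\<^sup>2) ^ 7) < 1"
    and e: "0 < e"
  obtains E where "E \<in> events"
    "{U \<in> space \<mu>. \<exists>x. L2_set x {..<n} = 1 \<and>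
      L2_set (\<lambda>i. d i * x i + (\<Sum>j<n. U $$ (i,j) * x j)) {..<n} \<le> t} \<subseteq> E"
    "prob E \<le> (1 + 3 * (real n)\<^sup>2) ^ 7 * (14 / N) + e"
proof -
  obtain M :: nat where M: "real n / e < real M" using reals_Archimedean2 by blast
  have M0: "M > 0" using M e n by (cases M) (auto simp: divide_less_0_iff)
  define h where "h = (\<lambda>i. t * (real i / real M))"
  define Z where "Z = (\<lambda>i. {U \<in> space \<mu>. sum_det_mat (diag_fun (\<lambda>k. d k + h i)) U = 0})"
  have "inj_on h {1..M}" using t M0 by (auto simp: inj_on_def h_def)
  then have "card {i \<in> {1..M}. U \<in> Z i} \<le> n" if "U \<in> space \<mu>" for U
    using card_singular_shifts[of U n "{1..M}" h d] that orthogonal_group_carrier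
    by (auto simp: Z_def space_haar)
  then have sum: "(\<Sum>i\<in>{1..M}. prob (Z i)) \<le> real n"
    by (intro sum_prob_le_multiplicity) (auto simp: Z_def)
  \<comment> \<open>Pigeonhole: more than n / e probabilities with sum at most n cannot all exceed
    \<open>e\<close>.\<close>
  obtain i where i: "i \<in> {1..M}" "prob (Z i) \<le> e"
  proof (rule ccontr)
    assume no: "\<not> thesis"
    have "e < prob (Z i)" if "i \<in> {1..M}" for i
      using that no \<open>\<And>i. \<lbrakk>i \<in> {1..M}; prob (Z i) \<le> e\<rbrakk> \<Longrightarrow> thesis\<close> by force
    then have "(\<Sum>i\<in>{1..M}. e) \<le> (\<Sum>i\<in>{1..M}. prob (Z i))" by (intro sum_mono) force
    then have "real M * e \<le> real n" using sum by simp
    then show False using M e by (simp add: field_simps)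
  qed
  have "real i / real M \<le> 1" using i(1) M0 by simp
  then have hi: "0 \<le> h i" "h i \<le> t" using t unfolding h_def by (simp, intro mult_left_le) auto
  \<comment> \<open>All entries are shifted by the same amount, so the gap is unchanged. The shift
    is at most t <= 1, which explains \<open>K + 1\<close> and \<open>2 * t\<close> in
    \<open>small\<close>.\<close>
  have d': "0 \<le> d k + h i \<and> d k + h i \<le> K + 1" if "k < n" for k
    using d[OF that] hi t by auto
  have gap': "4 * g \<le> \<bar>(d p + h i) - (d q + h i)\<bar>" "g \<le> K + 1" using gap(3) g by simp_all
  obtain E where E: "E \<in> events" "{U \<in> space \<mu>. \<exists>x. L2_set x {..<n} = 1 \<and>
      L2_set (\<lambda>k. (d k + h i) * x k + (\<Sum>j<n. U $$ (k,j) * x j)) {..<n} \<le> 2 * t} \<subseteq> E"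
    "prob E \<le> prob (Z i) + (1 + 3 * (real n)\<^sup>2) ^ 7 * (14 / N)"
    using prob_small_image_generic[OF n N d' g(1) gap'(2) gap(1,2) gap'(1) small] unfolding Z_def by blast
  have "{U \<in> space \<mu>. \<exists>x. L2_set x {..<n} = 1 \<and>
      L2_set (\<lambda>k. d k * x k + (\<Sum>j<n. U $$ (k,j) * x j)) {..<n} \<le> t} \<subseteq> E"
  proof
    fix U assume "U \<in> {U \<in> space \<mu>. \<exists>x. L2_set x {..<n} = 1 \<and>
      L2_set (\<lambda>k. d k * x k + (\<Sum>j<n. U $$ (k,j) * x j)) {..<n} \<le> t}"
    then obtain x where U: "U \<in> space \<mu>" and x: "L2_set x {..<n} = 1"
      "L2_set (\<lambda>k. d k * x k + (\<Sum>j<n. U $$ (k,j) * x j)) {..<n} \<le> t"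
      by blast
    have "L2_set (\<lambda>k. (d k + h i) * x k + (\<Sum>j<n. U $$ (k,j) * x j)) {..<n}
        = L2_set (\<lambda>k. (d k * x k + (\<Sum>j<n. U $$ (k,j) * x j)) + h i * x k) {..<n}"
      by (simp add: algebra_simps)
    also have "\<dots> \<le> L2_set (\<lambda>k. d k * x k + (\<Sum>j<n. U $$ (k,j) * x j)) {..<n}
        + L2_set (\<lambda>k. h i * x k) {..<n}"
      by (rule L2_set_triangle_ineq)
    also have "L2_set (\<lambda>k. h i * x k) {..<n} = h i"
      using hi x(1) by (simp add: L2_set_right_distrib[symmetric])
    finally have "L2_set (\<lambda>k. (d k + h i) * x k + (\<Sum>j<n. U $$ (k,j) * x j)) {..<n} \<le> 2 * t"
      using x(2) hi by linarith
    then show "U \<in> E" using E(2) U x(1) by blast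
  qed
  then show ?thesis using that E(1,3) i(2) by force
qed

end

section \<open>Assembly of the probability bound\<close>

lemma (in haar_orthogonal) prob_s_min_le:
  fixes D :: "real Matrix.mat"
  assumes n: "n \<ge> 2" and D: "D \<in> carrier_mat n n"
    and K: "K \<ge> 1" and \<delta>: "0 < \<delta>" "\<delta> < 1"
    and DK: "op_norm D \<le> K" and D\<delta>: "\<delta> \<le> (INF V\<in>orthogonal_group n. op_norm (D - V))"
    and t: "0 < t" "t < \<delta> / 2"
    and N: "N > 0" and small: "96 * 200 ^ 7 * (real n)\<^sup>2 * (K / \<delta>) * t * real N ^ 14 < 1"
  shows "prob {U \<in> space \<mu>. s_min (D + U) \<le> t} \<le> (1 + 3 * (real n)\<^sup>2) ^ 7 * (14 / N)"
proof -
  obtain V W d where VW: "V \<in> orthogonal_group n" "W \<in> orthogonal_group n"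
    and d0: "\<And>i. i < n \<Longrightarrow> 0 \<le> d i" and svd: "D = V * Matrix.mat n n (\<lambda>(i,j). diag_fun d i j) * W"
    using singular_value_decomposition[OF D] by blast
  have dK: "d i \<le> K" if "i < n" for i
    using svd_op_norm(1)[OF VW svd that] DK by linarith
  obtain p where p: "p < n" "\<delta> \<le> \<bar>d p - 1\<bar>"
    using exists_singular_value_away_from_1[OF VW svd \<delta>(1) D\<delta>] .
  define G where "G = (\<lambda>U :: real Matrix.mat. \<exists>x. L2_set x {..<n} = 1 \<and>
      L2_set (\<lambda>i. d i * x i + (\<Sum>j<n. U $$ (i,j) * x j)) {..<n} \<le> t)"
  define f where "f = (\<lambda>U. transpose_mat V * U * transpose_mat W)"
  have VW': "transpose_mat V \<in> orthogonal_group n" "transpose_mat W \<in> orthogonal_group n"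
    using VW orthogonal_group_transpose by auto
  have sub: "G (f U)" if "U \<in> space \<mu>" "s_min (D + U) \<le> t" for U
  proof -
    have "U \<in> carrier_mat n n" "0 < n"
      using that(1) n orthogonal_group_carrier by (auto simp: space_haar)
    then show ?thesis
      unfolding G_def f_def using s_min_svd_witness[OF VW _ svd _ that(2)] by blast
  qed
  have f: "f U \<in> orthogonal_group n" if "U \<in> space \<mu>" for U
    using that VW' by (auto simp: f_def space_haar intro!: orthogonal_group_mult)
  show ?thesis
  \<comment> \<open>Since \<open>d p\<close> is at distance at least \<delta> from 1, all entries
    closer than \<delta> / 2 to it lie on its side of 1, at distance at least \<delta> / 2 from
    1.\<close>
  proof (cases "\<exists>q<n. \<delta> / 2 \<le> \<bar>d p - d q\<bar>")
    case False
    then have near: "\<bar>d p - d q\<bar> < \<delta> / 2" if "q < n" for q using that by force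
    have side: "(\<forall>i<n. d i \<le> 1 - \<delta> / 2) \<or> (\<forall>i<n. 1 + \<delta> / 2 \<le> d i)"
    proof (cases "d p \<ge> 1")
      case True
      then have "1 + \<delta> / 2 \<le> d i" if "i < n" for i using p(2) near[OF that] by linarith
      then show ?thesis by blast
    next
      case False
      then have "d i \<le> 1 - \<delta> / 2" if "i < n" for i using p(2) near[OF that] by linarith
      then show ?thesis by blast
    qed
    have "\<not> G U" if "U \<in> orthogonal_group n" for U
      using no_small_image_if_same_side[OF that _ _ d0 side] \<delta> t unfolding G_def by force
    then have "{U \<in> space \<mu>. s_min (D + U) \<le> t} = {}" using sub f by blast
    then show ?thesis by (simp only: measure_empty) simp
  next
    case True
    then obtain q where q: "q < n" "\<delta> / 2 \<le> \<bar>d p - d q\<bar>" by blast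
    \<comment> \<open>The gap parameter g is \<delta> / 8. The factors 2, 3 and 8 give 48, and K + 1
      <= 2 K doubles this to the 96 in \<open>small\<close>.\<close>
    have p_q: "4 * (\<delta> / 8) \<le> \<bar>d p - d q\<bar>" using q by simp
    have d: "0 \<le> d i \<and> d i \<le> K" if "i < n" for i using d0 dK that by blast
    have "(real n)\<^sup>2 * (2 * t) * (3 * (K + 1) / (\<delta> / 8) * (200 * (real N)\<^sup>2) ^ 7)
        = 48 * 200 ^ 7 * (real n)\<^sup>2 * ((K + 1) / \<delta>) * t * real N ^ 14"
      by (simp add: power_mult_distrib power_mult[symmetric] mult_ac)
    also have "\<dots> \<le> 48 * 200 ^ 7 * (real n)\<^sup>2 * (2 * K / \<delta>) * t * real N ^ 14"
      using K \<delta> t by (intro mult_left_mono mult_right_mono divide_right_mono) auto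
    also have "\<dots> < 1" using small by simp
    finally have sm: "(real n)\<^sup>2 * (2 * t) * (3 * (K + 1) / (\<delta> / 8) * (200 * (real N)\<^sup>2) ^ 7) < 1" .
    show ?thesis
    \<comment> \<open>Removes the error \<open>e\<close> caused by the shift of the
      diagonal.\<close>
    proof (rule field_le_epsilon)
      fix e :: real assume e: "0 < e"
      obtain E where E: "E \<in> events" "{U \<in> space \<mu>. G U} \<subseteq> E"
        "prob E \<le> (1 + 3 * (real n)\<^sup>2) ^ 7 * (14 / N) + e"
      proof (rule prob_small_image[OF _ N t(1) _ d _ _ p(1) q(1) p_q sm e])
        show "0 < n" "t \<le> 1" "0 < \<delta> / 8" "\<delta> / 8 \<le> K" using n t \<delta> K by auto
      qed (use that in \<open>auto simp: G_def\<close>)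
      have "{U \<in> space \<mu>. U \<in> E} = E" using sets.sets_into_space[OF E(1)] by auto
      then have ev: "{U \<in> space \<mu>. U \<in> E} \<in> events" "prob {U \<in> space \<mu>. U \<in> E} = prob E"
        using E(1) by simp_all
      have "prob {U \<in> space \<mu>. s_min (D + U) \<le> t} \<le> prob {U \<in> space \<mu>. f U \<in> E}"
      proof (rule finite_measure_mono)
        show "{U \<in> space \<mu>. s_min (D + U) \<le> t} \<subseteq> {U \<in> space \<mu>. f U \<in> E}"
          using sub f E(2) by (auto simp: space_haar)
        show "{U \<in> space \<mu>. f U \<in> E} \<in> events"
          unfolding f_def by (rule prob_two_sided_mult(2)[OF VW' ev(1)])
      qed
      also have "\<dots> = prob E"
        unfolding f_def prob_two_sided_mult(1)[OF VW' ev(1)] ev(2) ..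
      finally show "prob {U \<in> space \<mu>. s_min (D + U) \<le> t}
          \<le> (1 + 3 * (real n)\<^sup>2) ^ 7 * (14 / N) + e"
        using E(3) by linarith
    qed
  qed
qed

theorem theorem1p2:
  shows "\<exists>C > (0::real). \<exists>c > (0::real).
    \<forall>(n::nat) (D :: real Matrix.mat) (K::real) (\<delta>::real) (\<mu> :: real Matrix.mat measure).
      n \<ge> 2 \<longrightarrow> D \<in> carrier_mat n n \<longrightarrow>
      K \<ge> 1 \<longrightarrow> 0 < \<delta> \<longrightarrow> \<delta> < 1 \<longrightarrow>
      op_norm D \<le> K \<longrightarrow>
      (INF V\<in>orthogonal_group n. op_norm (D - V)) \<ge> \<delta> \<longrightarrow>
      normalized_haar n \<mu> \<longrightarrow>
      (\<forall>t > (0::real). measure \<mu> {U \<in> space \<mu>. s_min (D + U) \<le> t}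
           \<le> t powr c * (K * real n / \<delta>) powr C)"
proof -
  have main: "measure \<mu> {U \<in> space \<mu>. s_min (D + U) \<le> t}
      \<le> t powr (1 / 14) * (K * real n / \<delta>) powr 38"
    if n: "n \<ge> 2" and D: "D \<in> carrier_mat n n" and K: "K \<ge> 1" and \<delta>: "0 < \<delta>" "\<delta> < 1"
      and DK: "op_norm D \<le> K" and D\<delta>: "\<delta> \<le> (INF V\<in>orthogonal_group n. op_norm (D - V))"
      and \<mu>: "normalized_haar n \<mu>" and t: "0 < t"
    for n :: nat and D :: "real Matrix.mat" and K \<delta> t :: real and \<mu> :: "real Matrix.mat measure"
  proof -
    interpret haar_orthogonal n \<mu> using \<mu> by unfold_locales
    define X where "X = K * real n / \<delta>"
    have K\<delta>: "1 \<le> K / \<delta>" using K \<delta> by (simp add: field_simps)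
    have Xn: "real n \<le> X" using mult_right_mono[OF K\<delta>, of "real n"] by (simp add: X_def)
    then have X2: "2 \<le> X" using n by linarith
    have "2 / \<delta> \<le> K * real n / \<delta>"
      using n K \<delta> mult_mono[of 1 K 2 "real n"] by (intro divide_right_mono) auto
    then have X\<delta>: "2 / \<delta> \<le> X" by (simp add: X_def)
    \<comment> \<open>Chosen so that N <= 1/\<tau> makes \<open>t * X ^ 66 * real N ^ 14\<close> at
      most 1. Here 66 = 64 + 2: \<open>X ^ 2\<close> absorbs the powers of n, K and 1/\<delta> in
      \<open>small\<close>, and \<open>X ^ 64\<close> absorbs 96 * 200^7, because X >= 2.\<close>
    define \<tau> where "\<tau> = (t * X ^ 66) powr (1 / 14)"
    have \<tau>: "0 < \<tau>" using t X2 by (simp add: \<tau>_def)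
    have \<tau>14: "\<tau> ^ 14 = t * X ^ 66"
    proof -
      have "\<tau> ^ 14 = \<tau> powr real 14" using \<tau> by (rule powr_realpow[symmetric])
      also have "\<dots> = (t * X ^ 66) powr 1" by (simp add: \<tau>_def powr_powr)
      also have "\<dots> = t * X ^ 66" using t X2 by simp
      finally show ?thesis .
    qed
    \<comment> \<open>Source of both exponents of the theorem: 33 + 66/14 is below 38.\<close>
    have bound: "X powr 33 * \<tau> \<le> t powr (1 / 14) * X powr 38"
    proof -
      have "\<tau> = t powr (1 / 14) * X powr (66 / 14)"
      proof -
        have "X ^ 66 = X powr real 66" using X2 by (intro powr_realpow[symmetric]) simp
        then have "(X ^ 66) powr (1 / 14) = X powr (real 66 * (1 / 14))" by (simp only: powr_powr)
        then have "(X ^ 66) powr (1 / 14) = X powr (66 / 14)" by (simp only: of_nat_numeral times_divide_eq_right mult_1_right)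
        moreover have "\<tau> = t powr (1 / 14) * (X ^ 66) powr (1 / 14)"
          unfolding \<tau>_def using t X2 by (intro powr_mult)
        ultimately show ?thesis by (simp only:)
      qed
      then have "X powr 33 * \<tau> = t powr (1 / 14) * X powr (33 + 66 / 14)"
        by (simp only: powr_add mult_ac)
      also have "\<dots> \<le> t powr (1 / 14) * X powr 38"
        using X2 by (intro mult_left_mono powr_mono) auto
      finally show ?thesis .
    qed
    have X33: "1 \<le> X powr 33" using X2 by (intro ge_one_powr_ge_zero) auto
    have "prob {U \<in> space \<mu>. s_min (D + U) \<le> t} \<le> X powr 33 * \<tau>"
    proof (cases "1 \<le> \<tau>")
      case True
      then have "1 * 1 \<le> X powr 33 * \<tau>" using X33 by (intro mult_mono) auto
      then show ?thesis using prob_le_1 order.trans by (metis mult_1)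
    next
      case False
      then have \<tau>1: "\<tau> < 1" by simp
      \<comment> \<open>Rounding down keeps \<open>small\<close> true; as 1/\<tau> >= 1, it costs at
        most a factor 2.\<close>
      define N where "N = nat \<lfloor>1 / \<tau>\<rfloor>"
      have "1 \<le> 1 / \<tau>" using \<tau> \<tau>1 by simp
      then have N1: "1 \<le> N" and N: "real N \<le> 1 / \<tau>" "1 / \<tau> < real N + 1"
        unfolding N_def by linarith+
      have N2: "1 / \<tau> \<le> 2 * real N" using N N1 by linarith
      have "\<tau> ^ 14 < 1" using \<tau> \<tau>1 by (simp add: power_less_one_iff)
      then have "t * X ^ 66 < 1" using \<tau>14 by simp
      moreover have "t * X \<le> t * X ^ 66" using t X2 by (intro mult_left_mono self_le_power) auto
      ultimately have "t * X < 1" by linarith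
      moreover have "t * (2 / \<delta>) \<le> t * X" using t X\<delta> by (intro mult_left_mono) auto
      ultimately have "t * (2 / \<delta>) < 1" by linarith
      then have t\<delta>: "t < \<delta> / 2" using \<delta> by (simp add: field_simps)
      have small: "96 * 200 ^ 7 * (real n)\<^sup>2 * (K / \<delta>) * t * real N ^ 14 < 1"
      proof -
        have "(real n)\<^sup>2 * (K / \<delta>) = real n * X" by (simp add: X_def power2_eq_square)
        also have "\<dots> \<le> X * X" using Xn X2 by (intro mult_right_mono) auto
        finally have a: "(real n)\<^sup>2 * (K / \<delta>) \<le> X ^ 2" by (simp add: power2_eq_square)
        have pos: "0 < (real n)\<^sup>2 * (K / \<delta>)" using n K \<delta> by (intro mult_pos_pos) auto
        have "(96 * 200 ^ 7 :: real) < 2 ^ 64" by simp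
        also have "(2::real) ^ 64 \<le> X ^ 64" using X2 by (intro power_mono) auto
        finally have b: "96 * 200 ^ 7 < X ^ 64" .
        have "96 * 200 ^ 7 * ((real n)\<^sup>2 * (K / \<delta>)) < X ^ 64 * X ^ 2"
          using a b pos by (intro mult_less_le_imp_less) auto
        then have c: "96 * 200 ^ 7 * ((real n)\<^sup>2 * (K / \<delta>)) < X ^ 66"
          by (simp add: power_add[symmetric])
        have "real N ^ 14 \<le> (1 / \<tau>) ^ 14" using N(1) by (intro power_mono) auto
        then have d: "t * real N ^ 14 \<le> t * (1 / (t * X ^ 66))"
          using t by (intro mult_left_mono) (simp_all add: power_one_over \<tau>14)
        have "96 * 200 ^ 7 * ((real n)\<^sup>2 * (K / \<delta>)) * (t * real N ^ 14) < X ^ 66 * (t * (1 / (t * X ^ 66)))"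
          using c d t N1 pos by (intro mult_less_le_imp_less) auto
        also have "\<dots> = 1" using t X2 by simp
        finally show ?thesis by (simp only: mult.assoc)
      qed
      have "prob {U \<in> space \<mu>. s_min (D + U) \<le> t} \<le> (1 + 3 * (real n)\<^sup>2) ^ 7 * (14 / real N)"
        using prob_s_min_le[OF n D K \<delta> DK D\<delta> t t\<delta> _ small] N1 by simp
      \<comment> \<open>33 = 4 * 7 + 5: 1 + 3 n^2 is at most \<open>X ^ 4\<close>, and 14/N <= 28
        \<tau>, where 28 < 2^5 <= \<open>X ^ 5\<close>.\<close>
      also have "\<dots> \<le> (X ^ 4) ^ 7 * (X ^ 5 * \<tau>)"
      proof (intro mult_mono power_mono)
        have "(real n)\<^sup>2 \<le> X\<^sup>2" using Xn by (intro power_mono) auto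
        moreover have "1 \<le> X\<^sup>2" using X2 by simp
        moreover have "2\<^sup>2 * X\<^sup>2 \<le> X\<^sup>2 * X\<^sup>2"
          using X2 by (intro mult_right_mono power_mono) auto
        ultimately show "1 + 3 * (real n)\<^sup>2 \<le> X ^ 4"
          by (simp add: power2_eq_square power4_eq_xxxx)
        have "14 / real N \<le> 28 * \<tau>" using N2 N1 \<tau> by (simp add: field_simps)
        also have "(2::real) ^ 5 \<le> X ^ 5" using X2 by (intro power_mono) auto
        then have "28 * \<tau> \<le> X ^ 5 * \<tau>" using \<tau> by (intro mult_right_mono) auto
        finally show "14 / real N \<le> X ^ 5 * \<tau>" .
      qed (use X2 in auto)
      also have "\<dots> = X powr 33 * \<tau>"
      proof -
        have "X powr 33 = X powr real 33" by simp
        also have "\<dots> = X ^ 33" using X2 by (intro powr_realpow) simp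
        finally have X33': "X powr 33 = X ^ 33" .
        have "(X ^ 4) ^ 7 * (X ^ 5 * \<tau>) = (X ^ (4 * 7) * X ^ 5) * \<tau>"
          by (simp only: power_mult mult.assoc)
        also have "X ^ (4 * 7) * X ^ 5 = X ^ 33" unfolding power_add[symmetric] by simp
        finally show ?thesis using X33' by simp
      qed
      finally show ?thesis .
    qed
    then show ?thesis using bound unfolding X_def by linarith
  qed
  show ?thesis
    by (rule exI[of _ 38], rule conjI, simp, rule exI[of _ "1 / 14"], rule conjI, simp)
      (intro allI impI main)
qed

end
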